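(* Let $n$ and $d$ be positive integers, $L$ a $(p,q)$-leaper with $p\ne0$ and $p<q$, and $M$ an $(r,s)$-leaper with \[\binom rs=A^{\mathrm{Pinwheel}}_n\binom pq,\qquad A^{\mathrm{Pinwheel}}_n=\begin{pmatrix}0&1\\1&2n\end{pmatrix}.\] Then the expanded pinwheel board $W_{n,d}(L)$ of order $n$ and margin $d$ for $L$ is dual with respect to $L$ and $M$. Furthermore, the leaper graph of $L$ over $W_{n,d}(L)$ is trivial (it contains no nontrivial cycle) and the direction graph extracted from it depends only on $n$ and $d$ (and not on $L$). Denote this direction graph by $W_{n,d}$. It is a dual direction graph of complement $\pi_{\mathrm{Pinwheel}}(W_{n,d})$ when $n$ is odd and $\pi_{\mathrm{Reflect}}\circ\pi_{\mathrm{Pinwheel}}(W_{n,d})$ when $n$ is even, and duality matrix $A^{\mathrm{Pinwheel}}_n$. Here $\pi_{\mathrm{Pinwheel}}$ is the permutation of the eight skew directions sending $1,2,3,4,5,6,7,8$ to $3,8,5,2,7,4,1,6$ respectively, and $\pi_{\mathrm{Reflect}}(i)=9-i$.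
   Context: A square is a unit square of the infinite chessboard; a board is a set of squares. For nonnegative integers $p,q$, not both zero, a $(p,q)$-leaper is a piece that moves from a square $a$ to any of $a+(\pm p,\pm q)$, $a+(\pm q,\pm p)$; a $(p,q)$-leaper and a $(q,p)$-leaper are the same leaper; it is skew if $p,q$ are nonzero and distinct. The leaper graph of $L$ over a board $B$ has the squares of $B$ as vertices, two being adjacent when a move of $L$ joins them. A board $B$ is dual with respect to two distinct leapers $L$ and $M$ if $B$ contains more than one square and the leaper graphs of $L$ and $M$ over $B$ are connected and isomorphic. Expanded pinwheel boards. Given a $(p,q)$-leaper $L$ with $q\ne0$, use Cartesian coordinates with origin $O$ over the infinite chessboard such that the integer points are the vertices of the squares if $p+q$ is odd, and the centers of the squares if $p+q$ is even; $(x,y)$ denotes the square centered at $(x,y)$. Let $N^{\mathrm I}(L)$ be the set of all squares $(x,y)$ with $x\equiv\frac12(p+q)$ and $y\equiv\frac12(p-q)$ modulo $2q$. Let $W^{\mathrm I}_{n,d}(L)$ be the board formed by all squares of $N^{\mathrm I}(L)$ whose centers lie on the boundary or in the interior of the rectangle bounded by $p-2dq\le x+y\le p+2(n+d)q$ and $-(2n+2d-1)q\le y-x\le(2n+2d-1)q$. Let $W^{\mathrm{II}}_{n,d}(L)$, $W^{\mathrm{III}}_{n,d}(L)$, $W^{\mathrm{IV}}_{n,d}(L)$ be the rotations of $W^{\mathrm I}_{n,d}(L)$ by $90^\circ$, $180^\circ$, and $270^\circ$ counterclockwise about $O$. The expanded pinwheel board $W_{n,d}(L)$ is the union of these four boards.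 Direction graphs. Let $A_1=\begin{pmatrix}0&1\\1&0\end{pmatrix}$, $A_2=\begin{pmatrix}1&0\\0&1\end{pmatrix}$, $A_3=\begin{pmatrix}-1&0\\0&1\end{pmatrix}$, $A_4=\begin{pmatrix}0&-1\\1&0\end{pmatrix}$, and $A_{i+4}=-A_i$ for $i=1,\ldots,4$; these eight are the direction matrices. A move of a skew $(p,q)$-leaper, $p<q$, by a translation $v$ has (skew) direction $i\in\{1,\ldots,8\}$ and direction matrix $A_i$ if $v^T=A_i\binom pq$. A direction graph is a symmetric directed graph whose arcs are labeled with skew directions so that the sum of the associated direction matrices over every simple directed cycle (including two-cycles) is zero. Two direction graphs are the same if there is a label-preserving isomorphism between them. A simple cycle of a skew leaper is trivial if the sum of the direction matrices of its moves (in either orientation) is zero, and nontrivial otherwise. If a leaper graph $G$ of a skew leaper contains no nontrivial cycle, the direction graph extracted from $G$ has the squares of $G$ as vertices and, for each pair of adjacent squares $a,b$, an arc from $a$ to $b$ and an arc from $b$ to $a$, each labeled with the direction of the corresponding move. For a permutation $\pi$ of the skew directions, $\pi(\Phi)$ is obtained from $\Phi$ by applying $\pi$ to every arc label. Duality. For vertices $x,y$ in the same connected component of a direction graph, the distance from $x$ to $y$ is the sum of the direction matrices along any path from $x$ to $y$ (it does not depend on the path). A direction graph is coherent if, for all such $x,y$, the distance from $x$ to $y$ is the zero matrix if and only if $x=y$, and is a direction matrix if and only if $x$ and $y$ are joined by an arc. A direction graph $\Phi$ is dual if there exist a direction graph $\Phi'$ (a complement of $\Phi$), a one-to-one mapping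 $\eta$ between the vertex sets of $\Phi$ and $\Phi'$, and a real $2\times2$ matrix $A_{\mathrm{Dual}}$ (the duality matrix), distinct from all direction matrices, such that: $\Phi$ and $\Phi'$ are coherent and connected; the unlabeled symmetric directed graphs underlying $\Phi$ and $\Phi'$ are isomorphic; and for every arc from $\eta(a)$ to $\eta(b)$ labeled $i$ in $\Phi'$, the distance from $a$ to $b$ in $\Phi$ equals $A_iA_{\mathrm{Dual}}$. *)

theory Defs
  imports
    "HOL-Analysis.Analysis"
    "HOL-Library.Real_Mod"
    "Graph_Theory.Pair_Digraph"
    "Graph_Theory.Digraph_Isomorphism"
begin

section \<open>Leapers and boards\<close>

text \<open>A square is represented by its center, in Cartesian coordinates with origin \<open>O\<close>.
  For a \<open>(p,q)\<close>-leaper the centers are the points both of whose coordinates are integers if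
  \<open>p + q\<close> is even, and proper half-integers if \<open>p + q\<close> is odd.\<close>

type_synonym square = "real ^ 2"

definition chessboard :: "nat \<Rightarrow> nat \<Rightarrow> square set" where
  "chessboard p q = {c. \<forall>i. c $ i - real (p + q) / 2 \<in> \<int>}"

text \<open>A leaper is identified with the set of translations by which it moves, so that
  the \<open>(p,q)\<close>-leaper and the \<open>(q,p)\<close>-leaper are equal.\<close>

definition leaper :: "nat \<Rightarrow> nat \<Rightarrow> (real ^ 2) set" where
  "leaper p q =
     {vector [\<sigma> * real p, \<tau> * real q] | \<sigma> \<tau>. \<sigma> \<in> {1, -1} \<and> \<tau> \<in> {1, -1}} \<union>
     {vector [\<sigma> * real q, \<tau> * real p] | \<sigma> \<tau>. \<sigma> \<in> {1, -1} \<and> \<tau> \<in> {1, -1}}"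

text \<open>Undirected graphs are symmetric digraphs.\<close>

definition leaper_graph :: "(real ^ 2) set \<Rightarrow> square set \<Rightarrow> square pair_pre_digraph" where
  "leaper_graph L B = \<lparr> pverts = B, parcs = {(a, b). a \<in> B \<and> b \<in> B \<and> b - a \<in> L} \<rparr>"

definition dual_board ::
  "square set \<Rightarrow> square set \<Rightarrow> (real ^ 2) set \<Rightarrow> (real ^ 2) set \<Rightarrow> bool" where
  "dual_board C B L M \<longleftrightarrow>
     B \<subseteq> C \<and> L \<noteq> M \<and> (\<exists>a\<in>B. \<exists>b\<in>B. a \<noteq> b) \<and>
     Digraph_Component.connected (with_proj (leaper_graph L B)) \<and>
     Digraph_Component.connected (with_proj (leaper_graph M B)) \<and>
     digraph_iso (with_proj (leaper_graph L B)) (with_proj (leaper_graph M B))"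

section \<open>Expanded pinwheel boards\<close>

definition pinwheel_net :: "nat \<Rightarrow> nat \<Rightarrow> square set" where
  "pinwheel_net p q = {c. [c $ 1 = (real p + real q) / 2] (rmod (2 * real q)) \<and>
                          [c $ 2 = (real p - real q) / 2] (rmod (2 * real q))}"

definition pinwheel_wing :: "nat \<Rightarrow> nat \<Rightarrow> nat \<Rightarrow> nat \<Rightarrow> square set" where
  "pinwheel_wing n d p q = {c \<in> pinwheel_net p q.
     real p - 2 * real d * real q \<le> c $ 1 + c $ 2 \<and>
     c $ 1 + c $ 2 \<le> real p + 2 * (real n + real d) * real q \<and>
     - (2 * real n + 2 * real d - 1) * real q \<le> c $ 2 - c $ 1 \<and>
     c $ 2 - c $ 1 \<le> (2 * real n + 2 * real d - 1) * real q}"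

definition rot90 :: "real ^ 2 \<Rightarrow> real ^ 2" where
  "rot90 c = vector [- (c $ 2), c $ 1]"

definition expanded_pinwheel :: "nat \<Rightarrow> nat \<Rightarrow> nat \<Rightarrow> nat \<Rightarrow> square set" where
  "expanded_pinwheel n d p q = (\<Union>k<4. (rot90 ^^ k) ` pinwheel_wing n d p q)"

definition pinwheel_matrix :: "nat \<Rightarrow> real ^ 2 ^ 2" where
  "pinwheel_matrix n = vector [vector [0, 1], vector [1, 2 * real n]]"

section \<open>Direction graphs\<close>

text \<open>The skew directions are the numbers \<open>1, \<dots>, 8\<close>.\<close>

definition directions :: "nat set" where
  "directions = {1..8}"

definition base_matrices :: "(real ^ 2 ^ 2) list" where
  "base_matrices =
    [vector [vector [0, 1], vector [1, 0]],
     vector [vector [1, 0], vector [0, 1]],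
     vector [vector [-1, 0], vector [0, 1]],
     vector [vector [0, -1], vector [1, 0]]]"

definition dir_matrix :: "nat \<Rightarrow> real ^ 2 ^ 2" where
  "dir_matrix i = (base_matrices @ map uminus base_matrices) ! (i - 1)"

text \<open>Only meaningful when \<open>v\<close> is a move of the \<open>(p,q)\<close>-leaper and \<open>0 < p < q\<close>, in which case
  the direction is unique.\<close>

definition move_direction :: "nat \<Rightarrow> nat \<Rightarrow> real ^ 2 \<Rightarrow> nat" where
  "move_direction p q v =
     (THE i. i \<in> directions \<and> v = dir_matrix i *v vector [real p, real q])"

record 'v labeled_digraph =
  underlying :: "'v pair_pre_digraph"
  label :: "'v \<times> 'v \<Rightarrow> nat"

abbreviation dg :: "'v labeled_digraph \<Rightarrow> ('v, 'v \<times> 'v) pre_digraph" where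
  "dg \<Phi> \<equiv> with_proj (underlying \<Phi>)"

definition label_sum :: "'v labeled_digraph \<Rightarrow> ('v \<times> 'v) awalk \<Rightarrow> real ^ 2 ^ 2" where
  "label_sum \<Phi> P = sum_list (map (\<lambda>e. dir_matrix (label \<Phi> e)) P)"

text \<open>Two-cycles count as cycles for \<^const>\<open>pre_digraph.cycle\<close>. Loops are excluded automatically,
  as they would be cycles with nonzero sum.\<close>

definition direction_graph :: "'v labeled_digraph \<Rightarrow> bool" where
  "direction_graph \<Phi> \<longleftrightarrow>
     pair_sym_digraph (underlying \<Phi>) \<and>
     label \<Phi> ` parcs (underlying \<Phi>) \<subseteq> directions \<and>
     (\<forall>P. pre_digraph.cycle (dg \<Phi>) P \<longrightarrow> label_sum \<Phi> P = 0)"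

definition same_direction_graph :: "'v labeled_digraph \<Rightarrow> 'w labeled_digraph \<Rightarrow> bool" where
  "same_direction_graph \<Phi> \<Psi> \<longleftrightarrow>
     (\<exists>f. pre_digraph.digraph_isomorphism (dg \<Phi>) f \<and> dg \<Psi> = app_iso f (dg \<Phi>) \<and>
          (\<forall>e \<in> parcs (underlying \<Phi>). label \<Psi> (iso_arcs f e) = label \<Phi> e))"

definition relabel :: "(nat \<Rightarrow> nat) \<Rightarrow> 'v labeled_digraph \<Rightarrow> 'v labeled_digraph" where
  "relabel \<pi> \<Phi> = \<Phi>\<lparr> label := \<pi> \<circ> label \<Phi> \<rparr>"

definition pi_pinwheel :: "nat \<Rightarrow> nat" where
  "pi_pinwheel i = [3, 8, 5, 2, 7, 4, 1, 6] ! (i - 1)"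

definition pi_reflect :: "nat \<Rightarrow> nat" where
  "pi_reflect i = 9 - i"

text \<open>The labeled graph extracted from the leaper graph of the \<open>(p,q)\<close>-leaper over \<open>B\<close>; it is a
  direction graph when that leaper graph is trivial.\<close>

definition extracted_graph :: "nat \<Rightarrow> nat \<Rightarrow> square set \<Rightarrow> square labeled_digraph" where
  "extracted_graph p q B =
     \<lparr> underlying = leaper_graph (leaper p q) B,
       label = (\<lambda>(a, b). move_direction p q (b - a)) \<rparr>"

text \<open>The graph written \<open>W\<close> with indices \<open>n, d\<close>, as obtained from the \<open>(p,q)\<close>-leaper.\<close>

definition pinwheel_graph :: "nat \<Rightarrow> nat \<Rightarrow> nat \<Rightarrow> nat \<Rightarrow> square labeled_digraph" where
  "pinwheel_graph n d p q = extracted_graph p q (expanded_pinwheel n d p q)"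

text \<open>In the digraph rendering \<^const>\<open>pre_digraph.cycle\<close> also admits the back-and-forth walks
  \<open>a, b, a\<close>. Their two moves have opposite direction matrices, so they are never nontrivial.\<close>

definition nontrivial_cycle :: "nat \<Rightarrow> nat \<Rightarrow> square set \<Rightarrow> (square \<times> square) awalk \<Rightarrow> bool" where
  "nontrivial_cycle p q B P \<longleftrightarrow>
     pre_digraph.cycle (with_proj (leaper_graph (leaper p q) B)) P \<and>
     sum_list (map (\<lambda>(a, b). dir_matrix (move_direction p q (b - a))) P) \<noteq> 0"

definition trivial_leaper_graph :: "nat \<Rightarrow> nat \<Rightarrow> square set \<Rightarrow> bool" where
  "trivial_leaper_graph p q B \<longleftrightarrow> \<not> (\<exists>P. nontrivial_cycle p q B P)"

section \<open>Duality\<close>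

text \<open>Well defined when \<open>\<Phi>\<close> is a direction graph in which \<open>y\<close> is reachable from \<open>x\<close>: all paths from
  \<open>x\<close> to \<open>y\<close> then have the same sum.\<close>

definition distance :: "'v labeled_digraph \<Rightarrow> 'v \<Rightarrow> 'v \<Rightarrow> real ^ 2 ^ 2" where
  "distance \<Phi> x y = (THE D. \<exists>P. pre_digraph.apath (dg \<Phi>) x P y \<and> label_sum \<Phi> P = D)"

definition coherent :: "'v labeled_digraph \<Rightarrow> bool" where
  "coherent \<Phi> \<longleftrightarrow>
     (\<forall>x y. reachable (dg \<Phi>) x y \<longrightarrow>
        (distance \<Phi> x y = 0 \<longleftrightarrow> x = y) \<and>
        (distance \<Phi> x y \<in> dir_matrix ` directions \<longleftrightarrow> (x, y) \<in> parcs (underlying \<Phi>)))"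

text \<open>\<open>\<Phi>\<close> is a dual direction graph with complement \<open>\<Phi>'\<close> and duality matrix \<open>A\<close>.\<close>

definition dual_direction_graph ::
  "'v labeled_digraph \<Rightarrow> 'w labeled_digraph \<Rightarrow> real ^ 2 ^ 2 \<Rightarrow> bool" where
  "dual_direction_graph \<Phi> \<Phi>' A \<longleftrightarrow>
     direction_graph \<Phi> \<and> direction_graph \<Phi>' \<and>
     A \<notin> dir_matrix ` directions \<and>
     coherent \<Phi> \<and> Digraph_Component.connected (dg \<Phi>) \<and>
     coherent \<Phi>' \<and> Digraph_Component.connected (dg \<Phi>') \<and>
     digraph_iso (dg \<Phi>) (dg \<Phi>') \<and>
     (\<exists>\<eta>. bij_betw \<eta> (pverts (underlying \<Phi>)) (pverts (underlying \<Phi>')) \<and>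
        (\<forall>a \<in> pverts (underlying \<Phi>). \<forall>b \<in> pverts (underlying \<Phi>).
           (\<eta> a, \<eta> b) \<in> parcs (underlying \<Phi>') \<longrightarrow>
           distance \<Phi> a b = dir_matrix (label \<Phi>' (\<eta> a, \<eta> b)) ** A))"

end

theory Submission
  imports Defs
begin

text \<open>
  Every square of the board is half of an integer matrix \<open>X\<close> applied to \<open>(p, q)\<close>. The first column of
  \<open>X\<close> has entries \<open>1\<close> and \<open>-1\<close> and tells the wing; the second column satisfies congruences modulo \<open>4\<close>
  and the inequalities of the rectangle. These conditions do not involve \<open>p\<close> and \<open>q\<close>.

  By \<open>pinwheel_move_rigid\<close>, squares with matrices \<open>X\<close> and \<open>Y\<close> are joined by a move of \<open>L\<close> if and only if
  \<open>(Y - X) / 2\<close> is a direction matrix, and by a move of \<open>M\<close> if and only if it is a direction matrix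
  times the pinwheel matrix \<open>A\<close> of order \<open>n\<close>. This uses only \<open>0 < p < q\<close> and the congruences, with no
  coprimality. So the extracted graph is independent of \<open>L\<close> (\<open>same_pinwheel_graph\<close>), and the sum
  of the direction matrices along a walk telescopes to the difference of the positions at its ends
  (\<open>placed_digraph\<close>). Hence there are no nontrivial cycles, distances are differences of positions, and
  coherence is immediate.

  Duality comes from one linear map. Let \<open>J\<close> be the quarter turn with rows \<open>(0, 1)\<close> and \<open>(-1, 0)\<close>, and
  \<open>S\<close> the diagonal matrix with entries \<open>1, 1\<close> for odd \<open>n\<close> and \<open>1, -1\<close> for even \<open>n\<close>. The map
  \<open>X \<mapsto> S ** X ** J ** A\<close> is an involution of the set of matrices of the board (\<open>dual_map_in_quads\<close>);
  \<open>S\<close> is needed for the congruences to be respected. As \<open>X \<mapsto> S ** X ** J\<close> permutes the direction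
  matrices, the involution carries moves of \<open>L\<close> exactly to moves of \<open>M\<close>, so the two leaper graphs are
  isomorphic. The induced permutation of the directions is the pinwheel permutation for odd \<open>n\<close>, and
  its composition with the reflection for even \<open>n\<close> (\<open>dual_turn_dir_matrix\<close>). The
  matrices \<open>S ** X ** J / 2\<close> are thus positions for the relabeled graph, which makes it coherent
  and identifies it as the complement with duality matrix \<open>A\<close>.

  What remains is connectedness for \<open>L\<close> (\<open>quads_linked\<close>): pairs of moves lead from any
  square to the inner edge of its wing, from there to inner corners, and around all four wings.
\<close>

section \<open>Graphs whose vertices carry matrix positions\<close>

lemma connected_of_rtrancl:
  assumes "parcs G \<subseteq> pverts G \<times> pverts G" and "pverts G \<noteq> {}"
    and "\<And>u v. u \<in> pverts G \<Longrightarrow> v \<in> pverts G \<Longrightarrow> (u, v) \<in> (parcs G)\<^sup>*"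
  shows "Digraph_Component.connected (with_proj G)"
proof -
  have "(u, v) \<in> rtrancl_on (pverts G) ((parcs G)\<^sup>s)"
    if "(u, v) \<in> (parcs G)\<^sup>*" "u \<in> pverts G" for u v
    using that
  proof (induction rule: rtrancl_induct)
    case base
    then show ?case by simp
  next
    case (step y z)
    then have "(y, z) \<in> (parcs G)\<^sup>s" and "z \<in> pverts G"
      using assms(1) by (auto simp: symcl_def)
    with step show ?case
      by (blast intro: rtrancl_on_into_rtrancl_on)
  qed
  then show ?thesis
    using assms by (simp add: connected_conv)
qed

text \<open>The isomorphism induced by a map of vertices between graphs whose arcs are ordered pairs.\<close>

definition pair_isomorphism ::
  "('v \<Rightarrow> 'w) \<Rightarrow> ('v, 'v \<times> 'v, 'w, 'w \<times> 'w) digraph_isomorphism" where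
  "pair_isomorphism f =
     \<lparr> iso_verts = f, iso_arcs = map_prod f f, iso_head = snd, iso_tail = fst \<rparr>"

lemma pair_isomorphism:
  assumes "parcs G \<subseteq> pverts G \<times> pverts G" and "parcs H \<subseteq> pverts H \<times> pverts H"
    and "bij_betw f (pverts G) (pverts H)"
    and "\<And>u v. u \<in> pverts G \<Longrightarrow> v \<in> pverts G \<Longrightarrow>
            (f u, f v) \<in> parcs H \<longleftrightarrow> (u, v) \<in> parcs G"
  shows "pre_digraph.digraph_isomorphism (with_proj G) (pair_isomorphism f)"
    and "with_proj H = app_iso (pair_isomorphism f) (with_proj G)"
proof -
  have inj: "inj_on f (pverts G)" and img: "f ` pverts G = pverts H"
    using assms(3) by (auto simp: bij_betw_def)
  have "inj_on (map_prod f f) (parcs G)"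
    using inj assms(1) by (intro inj_on_subset[OF map_prod_inj_on[OF inj inj]])
  moreover have "wf_digraph (with_proj G)"
    using assms(1) by unfold_locales auto
  ultimately show "pre_digraph.digraph_isomorphism (with_proj G) (pair_isomorphism f)"
    using inj by (auto simp: pre_digraph.digraph_isomorphism_def pair_isomorphism_def)
  have "parcs H = map_prod f f ` parcs G"
  proof (intro equalityI subsetI)
    fix e assume e: "e \<in> parcs H"
    then have "e \<in> f ` pverts G \<times> f ` pverts G"
      using assms(2) unfolding img by blast
    then obtain u v where uv: "u \<in> pverts G" "v \<in> pverts G" "e = (f u, f v)"
      by blast
    then have "(u, v) \<in> parcs G" using e assms(4) by simp
    then show "e \<in> map_prod f f ` parcs G" using uv(3) by force
  next
    fix e assume "e \<in> map_prod f f ` parcs G"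
    then obtain u v where "(u, v) \<in> parcs G" "e = (f u, f v)" by auto
    then show "e \<in> parcs H" using assms(1,4) by auto
  qed
  then show "with_proj H = app_iso (pair_isomorphism f) (with_proj G)"
    using img by (simp add: app_iso_def pair_isomorphism_def with_proj_def)
qed

text \<open>A labeled graph with a position matrix at every vertex, in which two vertices are joined
  exactly when their positions differ by a direction matrix, and the label names that matrix. Sums
  along walks then telescope.\<close>

locale placed_digraph =
  fixes \<Phi> :: "'v labeled_digraph" and P :: "'v \<Rightarrow> real ^ 2 ^ 2"
  assumes inj_P: "inj_on P (pverts (underlying \<Phi>))"
    and arc_iff: "(x, y) \<in> parcs (underlying \<Phi>) \<longleftrightarrow>
      x \<in> pverts (underlying \<Phi>) \<and> y \<in> pverts (underlying \<Phi>) \<and>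
      P y - P x \<in> dir_matrix ` directions"
    and label_in: "(x, y) \<in> parcs (underlying \<Phi>) \<Longrightarrow> label \<Phi> (x, y) \<in> directions"
    and label_matrix: "(x, y) \<in> parcs (underlying \<Phi>) \<Longrightarrow>
      dir_matrix (label \<Phi> (x, y)) = P y - P x"
begin

lemma label_sum_awalk:
  assumes "pre_digraph.awalk (dg \<Phi>) x W y"
  shows "label_sum \<Phi> W = P y - P x"
proof -
  have "pcas x W y" "set W \<subseteq> parcs (underlying \<Phi>)"
    using assms by (auto simp: pre_digraph.awalk_def cas_with_proj_eq)
  then show ?thesis
  proof (induction x W y rule: pcas.induct)
    case (2 u e es v)
    then show ?case
      using label_matrix[of "fst e" "snd e"] by (cases e) (simp add: label_sum_def)
  qed (simp add: label_sum_def)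
qed

lemma cycle_sum:
  "pre_digraph.cycle (dg \<Phi>) W \<Longrightarrow> label_sum \<Phi> W = 0"
  by (auto simp: pre_digraph.cycle_def dest: label_sum_awalk)

lemma wf: "wf_digraph (dg \<Phi>)"
  by unfold_locales (auto simp: arc_iff)

lemma direction_graph:
  assumes "\<And>A. A \<in> dir_matrix ` directions \<Longrightarrow> - A \<in> dir_matrix ` directions"
  shows "direction_graph \<Phi>"
proof -
  have "sym (parcs (underlying \<Phi>))"
    using assms by (intro symI) (metis arc_iff minus_diff_eq)
  then have "pair_sym_digraph (underlying \<Phi>)"
    by unfold_locales (auto simp: arc_iff symmetric_def)
  then show ?thesis
    using label_in cycle_sum by (auto simp: direction_graph_def)
qed

lemma distance_eq:
  assumes "reachable (dg \<Phi>) x y"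
  shows "distance \<Phi> x y = P y - P x"
proof -
  obtain W where "pre_digraph.apath (dg \<Phi>) x W y"
    using assms wf_digraph.reachable_apath[OF wf] by blast
  moreover have "label_sum \<Phi> W' = P y - P x"
    if "pre_digraph.apath (dg \<Phi>) x W' y" for W'
    using that label_sum_awalk by (auto simp: pre_digraph.apath_def)
  ultimately show ?thesis
    unfolding distance_def by (intro the_equality) auto
qed

lemma coherent: "coherent \<Phi>"
  unfolding coherent_def
proof (intro allI impI)
  fix x y assume r: "reachable (dg \<Phi>) x y"
  then have xy: "x \<in> pverts (underlying \<Phi>)" "y \<in> pverts (underlying \<Phi>)"
    by (auto elim: reachable_in_vertsE)
  then show "(distance \<Phi> x y = 0 \<longleftrightarrow> x = y) \<and>
    (distance \<Phi> x y \<in> dir_matrix ` directions \<longleftrightarrow> (x, y) \<in> parcs (underlying \<Phi>))"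
    using inj_onD[OF inj_P] by (auto simp: distance_eq[OF r] arc_iff)
qed

end

section \<open>Direction matrices in coordinates\<close>

abbreviation mat2 :: "real \<Rightarrow> real \<Rightarrow> real \<Rightarrow> real \<Rightarrow> real ^ 2 ^ 2" where
  "mat2 a b c e \<equiv> vector [vector [a, b], vector [c, e]]"

lemma mat2_eq_iff:
  "A = mat2 a b c e \<longleftrightarrow> A $ 1 $ 1 = a \<and> A $ 1 $ 2 = b \<and> A $ 2 $ 1 = c \<and> A $ 2 $ 2 = e"
  by (auto simp: vec_eq_iff forall_2)

lemma mat2_mult:
  "mat2 a b c e ** mat2 a' b' c' e' =
     mat2 (a * a' + b * c') (a * b' + b * e') (c * a' + e * c') (c * b' + e * e')"
  by (simp add: vec_eq_iff forall_2 matrix_matrix_mult_def sum_2)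

lemma mat2_mult_vec: "mat2 a b c e *v vector [x, y] = vector [a * x + b * y, c * x + e * y]"
  by (simp add: vec_eq_iff forall_2 matrix_vector_mult_def sum_2)

lemma mat2_diff: "mat2 a b c e - mat2 a' b' c' e' = mat2 (a - a') (b - b') (c - c') (e - e')"
  by (simp add: vec_eq_iff forall_2)

lemma directions_eq: "directions = {1, 2, 3, 4, 5, 6, 7, 8}"
  by (auto simp: directions_def)

lemma dir_matrix_simps:
  "dir_matrix 1 = mat2 0 1 1 0" "dir_matrix 2 = mat2 1 0 0 1"
  "dir_matrix 3 = mat2 (-1) 0 0 1" "dir_matrix 4 = mat2 0 (-1) 1 0"
  "dir_matrix 5 = mat2 0 (-1) (-1) 0" "dir_matrix 6 = mat2 (-1) 0 0 (-1)"
  "dir_matrix 7 = mat2 1 0 0 (-1)" "dir_matrix 8 = mat2 0 1 (-1) 0"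
  by (simp_all add: dir_matrix_def base_matrices_def vec_eq_iff forall_2)

lemma dir_matrix_image:
  "dir_matrix ` directions =
     {mat2 0 1 1 0, mat2 1 0 0 1, mat2 (-1) 0 0 1, mat2 0 (-1) 1 0,
      mat2 0 (-1) (-1) 0, mat2 (-1) 0 0 (-1), mat2 1 0 0 (-1), mat2 0 1 (-1) 0}"
  by (simp only: directions_eq image_insert image_empty dir_matrix_simps)

lemma uminus_mat2: "- mat2 a b c e = mat2 (- a) (- b) (- c) (- e)"
  by (simp add: vec_eq_iff forall_2)

lemma uminus_dir_matrix: "A \<in> dir_matrix ` directions \<Longrightarrow> - A \<in> dir_matrix ` directions"
  unfolding dir_matrix_image by (elim insertE emptyE) (simp_all add: uminus_mat2)

section \<open>Positions as integer matrices\<close>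

text \<open>The quadruple \<open>(a, b, c, e)\<close> stands for the matrix with rows \<open>(a, b)\<close> and \<open>(c, e)\<close>. Half of it,
  applied to \<open>(p, q)\<close>, gives a square; doubling keeps all entries integral.\<close>

type_synonym quad = "int \<times> int \<times> int \<times> int"

text \<open>The quadruples of the squares of the expanded pinwheel board. The column \<open>(a, c)\<close> is
  \<open>(1, 1)\<close>, \<open>(-1, 1)\<close>, \<open>(-1, -1)\<close>, \<open>(1, -1)\<close> on the four wings in counterclockwise order. In the first
  wing \<open>a * b + c * e\<close> and \<open>a * e - c * b\<close> are twice the coefficients of \<open>q\<close> in \<open>x + y\<close> and \<open>y - x\<close>; both
  quantities are invariant under rotation, so the rectangle of every wing has the same
  description. The congruences encode the net of the wing.\<close>

definition quads :: "nat \<Rightarrow> nat \<Rightarrow> quad set" where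
  "quads n d = {(a, b, c, e). a \<in> {1, -1} \<and> c \<in> {1, -1} \<and> 4 dvd b - c \<and> 4 dvd e + a \<and>
     - 4 * int d \<le> a * b + c * e \<and> a * b + c * e \<le> 4 * (int n + int d) \<and>
     \<bar>a * e - c * b\<bar> \<le> 4 * (int n + int d) - 2}"

fun half_matrix :: "quad \<Rightarrow> real ^ 2 ^ 2" where
  "half_matrix (a, b, c, e) =
     mat2 (real_of_int a / 2) (real_of_int b / 2) (real_of_int c / 2) (real_of_int e / 2)"

definition square_at :: "nat \<Rightarrow> nat \<Rightarrow> quad \<Rightarrow> square" where
  "square_at p q X = half_matrix X *v vector [real p, real q]"

text \<open>Half of the difference of the two quadruples is a direction matrix times \<open>pinwheel_matrix m\<close>.
  For \<open>m = 0\<close> this is a move of \<open>L\<close>, because \<open>pinwheel_matrix 0\<close> only interchanges \<open>p\<close> and \<open>q\<close>;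
  for \<open>m = n\<close> it is a move of \<open>M\<close>.\<close>

fun quad_step :: "nat \<Rightarrow> quad \<Rightarrow> quad \<Rightarrow> bool" where
  "quad_step m (a, b, c, e) (a', b', c', e') \<longleftrightarrow>
     (\<exists>s\<in>{1, -1}. \<exists>t\<in>{1, -1}.
        a' - a = 0 \<and> b' - b = 2 * s \<and> c' - c = 2 * t \<and> e' - e = 4 * int m * t \<or>
        a' - a = 2 * s \<and> b' - b = 4 * int m * s \<and> c' - c = 0 \<and> e' - e = 2 * t)"

lemma square_at_simps:
  "square_at p q (a, b, c, e) =
     vector [(real_of_int a * real p + real_of_int b * real q) / 2,
             (real_of_int c * real p + real_of_int e * real q) / 2]"
  by (simp add: square_at_def mat2_mult_vec add_divide_distrib)

lemma vec2_eq_iff: "(vector [x, y] :: real ^ 2) = vector [x', y'] \<longleftrightarrow> x = x' \<and> y = y'"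
  by (simp add: vec_eq_iff forall_2)

lemma vec2_diff: "(vector [x, y] :: real ^ 2) - vector [x', y'] = vector [x - x', y - y']"
  by (simp add: vec_eq_iff forall_2)

lemma inj_half_matrix: "inj half_matrix"
  by (rule injI) (auto simp: mat2_eq_iff)

lemma pinwheel_image_iff:
  "A \<in> (\<lambda>A. A ** pinwheel_matrix m) ` dir_matrix ` directions \<longleftrightarrow>
     (\<exists>s\<in>{1, -1 :: int}. \<exists>t\<in>{1, -1 :: int}.
        A = mat2 0 (real_of_int s) (real_of_int t) (2 * real m * real_of_int t) \<or>
        A = mat2 (real_of_int s) (2 * real m * real_of_int s) 0 (real_of_int t))"
  unfolding dir_matrix_image pinwheel_matrix_def image_insert image_empty mat2_mult by simp blast

lemma dir_matrix_image_pinwheel_0: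
  "(\<lambda>A. A ** pinwheel_matrix 0) ` dir_matrix ` directions = dir_matrix ` directions"
  unfolding dir_matrix_image pinwheel_matrix_def image_insert image_empty mat2_mult
  by (simp add: insert_commute)

lemma half_matrix_diff_eq_iff:
  "half_matrix (a', b', c', e') - half_matrix (a, b, c, e) =
     mat2 (real_of_int x) (real_of_int y) (real_of_int z) (real_of_int w) \<longleftrightarrow>
   a' - a = 2 * x \<and> b' - b = 2 * y \<and> c' - c = 2 * z \<and> e' - e = 2 * w"
proof -
  have "real_of_int k' / 2 - real_of_int k / 2 = real_of_int l \<longleftrightarrow> k' - k = 2 * l" for k k' l
    by linarith
  then show ?thesis
    by (simp add: mat2_diff mat2_eq_iff)
qed

lemma quad_step_iff:
  "quad_step m X Y \<longleftrightarrow>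
     half_matrix Y - half_matrix X \<in> (\<lambda>A. A ** pinwheel_matrix m) ` dir_matrix ` directions"
proof -
  obtain a b c e where X: "X = (a, b, c, e)" by (cases X)
  obtain a' b' c' e' where Y: "Y = (a', b', c', e')" by (cases Y)
  note diff = half_matrix_diff_eq_iff[of a' b' c' e' a b c e]
  show ?thesis
    unfolding X Y pinwheel_image_iff quad_step.simps
    using diff[of 0 _ _ "2 * int m * _"] diff[of _ "2 * int m * _" 0]
    by (simp add: mult.assoc del: half_matrix.simps)
qed

lemma quad_step_0_iff:
  "quad_step 0 X Y \<longleftrightarrow> half_matrix Y - half_matrix X \<in> dir_matrix ` directions"
  unfolding quad_step_iff dir_matrix_image_pinwheel_0 ..

lemma quad_step_0_commute: "quad_step 0 X Y \<Longrightarrow> quad_step 0 Y X"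
  unfolding quad_step_0_iff by (drule uminus_dir_matrix) simp

text \<open>The arithmetic behind the independence of \<open>p\<close> and \<open>q\<close>: a nonzero \<open>y\<close> would give
  \<open>\<bar>x\<bar> \<le> k \<le> \<bar>y\<bar>\<close>, hence \<open>\<bar>x\<bar> * p < \<bar>y\<bar> * q\<close>.\<close>

lemma eq_zero_of_dvd:
  fixes x y p q k :: int
  assumes "x * p + y * q = 0" and "0 < p" and "p < q" and "\<bar>x\<bar> \<le> k" and "k dvd y"
  shows "x = 0" and "y = 0"
proof -
  have "\<bar>x\<bar> * p = \<bar>y\<bar> * q"
    using assms(1-3) by (metis abs_minus_cancel abs_mult abs_of_pos add_eq_0_iff less_trans)
  show y: "y = 0"
  proof (rule ccontr)
    assume "y \<noteq> 0"
    then have "\<bar>x\<bar> \<le> \<bar>y\<bar>"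
      using assms(4,5) dvd_imp_le_int[of y k] by linarith
    then have "\<bar>x\<bar> * p \<le> \<bar>y\<bar> * p"
      using assms(2) by (simp add: mult_right_mono)
    also have "\<dots> < \<bar>y\<bar> * q"
      using assms(3) \<open>y \<noteq> 0\<close> by simp
    finally show False
      using \<open>\<bar>x\<bar> * p = \<bar>y\<bar> * q\<close> by simp
  qed
  show "x = 0"
    using assms(1,2) y by simp
qed

text \<open>A move of either leaper between two squares of the board comes from an equality of matrices,
  although \<open>p\<close> and \<open>q\<close> may be dependent over the integers. Comparing coordinates gives two relations
  \<open>x * p + y * q = 0\<close>. One of them has \<open>\<bar>x\<bar> \<le> 2\<close> and \<open>y\<close> even, so it is trivial; with the congruences
  in \<^const>\<open>quads\<close> this makes the \<open>y\<close> of the other one divisible by \<open>4\<close>, while its \<open>\<bar>x\<bar>\<close> is at most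
  \<open>4\<close>.\<close>

lemma pinwheel_move_rigid:
  fixes p q :: nat
  assumes X: "X \<in> quads n d" and Y: "Y \<in> quads n d" and pq: "0 < p" "p < q"
    and A: "A \<in> (\<lambda>A. A ** pinwheel_matrix m) ` dir_matrix ` directions"
    and move: "square_at p q Y - square_at p q X = A *v vector [real p, real q]"
  shows "half_matrix Y - half_matrix X = A"
proof -
  obtain a b c e where X': "X = (a, b, c, e)" by (cases X)
  obtain a' b' c' e' where Y': "Y = (a', b', c', e')" by (cases Y)
  define \<alpha> \<beta> \<gamma> \<delta> where defs: "\<alpha> = a' - a" "\<beta> = b' - b" "\<gamma> = c' - c" "\<delta> = e' - e"
  have \<alpha>: "\<alpha> \<in> {-2, 0, 2}" and \<gamma>: "\<gamma> \<in> {-2, 0, 2}"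
    using X Y by (auto simp: X' Y' quads_def defs)
  have "4 dvd b - c" "4 dvd b' - c'" "4 dvd e + a" "4 dvd e' + a'"
    using X Y by (simp_all add: X' Y' quads_def)
  then have \<beta>: "4 dvd \<beta> - \<gamma>" and \<delta>: "4 dvd \<delta> + \<alpha>"
    unfolding defs by presburger+
  have ev: "even \<alpha>" "even \<gamma>" and bound: "\<bar>\<alpha>\<bar> \<le> 2" "\<bar>\<gamma>\<bar> \<le> 2"
    using \<alpha> \<gamma> by auto
  have pq': "0 < int p" "int p < int q"
    using pq by simp_all
  have half: "(real_of_int x' * real p + real_of_int y' * real q) / 2 -
      (real_of_int x * real p + real_of_int y * real q) / 2 =
      real_of_int u * real p + real_of_int v * real q \<longleftrightarrow>
    (x' - x - 2 * u) * int p + (y' - y - 2 * v) * int q = 0" for x x' y y' u v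
  proof -
    define S S' U where "S = real_of_int x * real p + real_of_int y * real q"
      and "S' = real_of_int x' * real p + real_of_int y' * real q"
      and "U = real_of_int u * real p + real_of_int v * real q"
    have "S' / 2 - S / 2 = U \<longleftrightarrow> S' - S - 2 * U = 0"
      by linarith
    also have "S' - S - 2 * U =
        real_of_int ((x' - x - 2 * u) * int p + (y' - y - 2 * v) * int q)"
      by (simp add: S_def S'_def U_def algebra_simps)
    finally show ?thesis
      unfolding of_int_eq_0_iff S_def S'_def U_def .
  qed
  from A obtain s t :: int where st: "s \<in> {1, -1}" "t \<in> {1, -1}" and
    "A = mat2 0 (real_of_int s) (real_of_int t) (2 * real m * real_of_int t) \<or>
     A = mat2 (real_of_int s) (2 * real m * real_of_int s) 0 (real_of_int t)"
    unfolding pinwheel_image_iff by blast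
  then show ?thesis
  proof (elim disjE)
    assume A: "A = mat2 0 (real_of_int s) (real_of_int t) (2 * real m * real_of_int t)"
    have "\<alpha> * int p + (\<beta> - 2 * s) * int q = 0"
      and "(\<gamma> - 2 * t) * int p + (\<delta> - 4 * int m * t) * int q = 0"
      using move half[of a' b' a b 0 s] half[of c' e' c e t "2 * int m * t"]
      by (simp_all add: X' Y' A defs square_at_simps vec2_diff mat2_mult_vec vec2_eq_iff mult.assoc)
    note rel = this
    have \<beta>': "2 dvd \<beta> - 2 * s" using \<beta> ev(2) by presburger
    have z: "\<alpha> = 0" "\<beta> - 2 * s = 0"
      using eq_zero_of_dvd[OF rel(1) pq' bound(1) \<beta>'] .
    then have \<delta>': "4 dvd \<delta> - 4 * int m * t" using \<delta> by simp
    have "\<bar>\<gamma> - 2 * t\<bar> \<le> 4"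
      using \<gamma> st(2) by auto
    then have "\<gamma> - 2 * t = 0" "\<delta> - 4 * int m * t = 0"
      using eq_zero_of_dvd[OF rel(2) pq' _ \<delta>'] by blast+
    with z show ?thesis
      using half_matrix_diff_eq_iff[of a' b' c' e' a b c e 0 s t "2 * int m * t"]
      by (simp add: X' Y' A defs mult.assoc del: half_matrix.simps)
  next
    assume A: "A = mat2 (real_of_int s) (2 * real m * real_of_int s) 0 (real_of_int t)"
    have "(\<alpha> - 2 * s) * int p + (\<beta> - 4 * int m * s) * int q = 0"
      and "\<gamma> * int p + (\<delta> - 2 * t) * int q = 0"
      using move half[of a' b' a b s "2 * int m * s"] half[of c' e' c e 0 t]
      by (simp_all add: X' Y' A defs square_at_simps vec2_diff mat2_mult_vec vec2_eq_iff mult.assoc)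
    note rel = this
    have \<delta>': "2 dvd \<delta> - 2 * t" using \<delta> ev(1) by presburger
    have z: "\<gamma> = 0" "\<delta> - 2 * t = 0"
      using eq_zero_of_dvd[OF rel(2) pq' bound(2) \<delta>'] .
    then have \<beta>': "4 dvd \<beta> - 4 * int m * s" using \<beta> by simp
    have "\<bar>\<alpha> - 2 * s\<bar> \<le> 4"
      using \<alpha> st(1) by auto
    then have "\<alpha> - 2 * s = 0" "\<beta> - 4 * int m * s = 0"
      using eq_zero_of_dvd[OF rel(1) pq' _ \<beta>'] by blast+
    with z show ?thesis
      using half_matrix_diff_eq_iff[of a' b' c' e' a b c e s "2 * int m * s" 0 t]
      by (simp add: X' Y' A defs mult.assoc del: half_matrix.simps)
  qed
qed

lemma inj_on_square_at:
  assumes "0 < p" and "p < q"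
  shows "inj_on (square_at p q) (quads n d)"
proof (rule inj_onI)
  fix X Y assume X: "X \<in> quads n d" and Y: "Y \<in> quads n d" and eq: "square_at p q X = square_at p q Y"
  obtain a b c e where X': "X = (a, b, c, e)" by (cases X)
  obtain a' b' c' e' where Y': "Y = (a', b', c', e')" by (cases Y)
  have "real_of_int ((a' - a) * int p + (b' - b) * int q) = 0"
    and "real_of_int ((c' - c) * int p + (e' - e) * int q) = 0"
    using eq by (simp_all add: X' Y' square_at_simps vec2_eq_iff algebra_simps)
  then have rel: "(a' - a) * int p + (b' - b) * int q = 0" "(c' - c) * int p + (e' - e) * int q = 0"
    by (simp_all only: of_int_eq_0_iff)
  have sgn: "a \<in> {1, -1}" "a' \<in> {1, -1}" "c \<in> {1, -1}" "c' \<in> {1, -1}"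
    and "4 dvd b - c" "4 dvd b' - c'" "4 dvd e + a" "4 dvd e' + a'"
    using X Y by (simp_all add: X' Y' quads_def)
  moreover from sgn have "\<bar>a' - a\<bar> \<le> 2" "\<bar>c' - c\<bar> \<le> 2" "2 dvd a' - a" "2 dvd c' - c"
    by auto
  moreover from calculation have "2 dvd b' - b" "2 dvd e' - e"
    by presburger+
  ultimately show "X = Y"
    using eq_zero_of_dvd[OF rel(1), of 2] eq_zero_of_dvd[OF rel(2), of 2] assms
    by (simp add: X' Y')
qed

section \<open>The involution that exchanges the two leapers\<close>

text \<open>The sign that distinguishes the two parities of \<open>n\<close> in the definition of the duality map.\<close>

definition dual_sign :: "nat \<Rightarrow> int" where
  "dual_sign n = (if odd n then 1 else -1)"

text \<open>The bijection of the board that carries the graph of \<open>L\<close> to that of \<open>M\<close>. As a matrix, \<open>X\<close> goes to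
  \<open>S ** X ** K\<close>, where \<open>K\<close> has rows \<open>(1, 2 * n)\<close> and \<open>(0, -1)\<close>, and \<open>S\<close> is diagonal with entries \<open>1\<close>
  and \<open>dual_sign n\<close>. For odd \<open>n\<close> it reflects every wing in its center. For even \<open>n\<close> that reflection would
  not preserve the net, and the map interchanges wings instead.\<close>

fun dual_map :: "nat \<Rightarrow> quad \<Rightarrow> quad" where
  "dual_map n (a, b, c, e) =
     (a, 2 * int n * a - b, dual_sign n * c, dual_sign n * (2 * int n * c - e))"

lemma dual_sign_cases: "odd n \<and> dual_sign n = 1 \<or> even n \<and> dual_sign n = -1"
  by (simp add: dual_sign_def)

lemma dual_map_involution: "dual_map n (dual_map n X) = X"
  using dual_sign_cases[of n] by (cases X) auto

lemma dual_map_in_quads: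
  assumes "X \<in> quads n d"
  shows "dual_map n X \<in> quads n d"
proof -
  obtain a b c e where X: "X = (a, b, c, e)" by (cases X)
  define \<sigma> where "\<sigma> = dual_sign n"
  define U T where "U = a * b + c * e" and "T = a * e - c * b"
  have ac: "a = 1 \<or> a = -1" "c = 1 \<or> c = -1" and dvd: "4 dvd b - c" "4 dvd e + a"
    and UT: "- 4 * int d \<le> U" "U \<le> 4 * (int n + int d)" "\<bar>T\<bar> \<le> 4 * (int n + int d) - 2"
    using assms by (simp_all add: X quads_def U_def T_def)
  have \<sigma>: "odd n \<and> \<sigma> = 1 \<or> even n \<and> \<sigma> = -1"
    unfolding \<sigma>_def by (rule dual_sign_cases)
  have U': "a * (2 * int n * a - b) + (\<sigma> * c) * (\<sigma> * (2 * int n * c - e)) = 4 * int n - U"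
    and T': "a * (\<sigma> * (2 * int n * c - e)) - (\<sigma> * c) * (2 * int n * a - b) = - (\<sigma> * T)"
    using ac \<sigma> by (auto simp: U_def T_def)
  have "\<bar>\<sigma> * T\<bar> = \<bar>T\<bar>"
    using \<sigma> by auto
  moreover have "4 dvd 2 * int n * a - b - \<sigma> * c" "4 dvd \<sigma> * (2 * int n * c - e) + a"
    using ac \<sigma> dvd by (elim disjE conjE; simp; presburger)+
  moreover have "\<sigma> * c \<in> {1, -1}"
    using ac \<sigma> by auto
  ultimately show ?thesis
    using ac UT unfolding X dual_map.simps \<sigma>_def[symmetric] quads_def mem_Collect_eq prod.case U' T'
    by simp
qed

lemma bij_dual_map: "bij_betw (dual_map n) (quads n d) (quads n d)"
  by (rule bij_betwI[where g = "dual_map n"]) (auto simp: dual_map_in_quads dual_map_involution)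

text \<open>\<open>K\<close> is a quarter turn times \<open>pinwheel_matrix n\<close>, and the set of direction matrices is stable under
  the quarter turn and under \<open>S\<close>.\<close>

lemma quad_step_dual_map: "quad_step n (dual_map n X) (dual_map n Y) \<longleftrightarrow> quad_step 0 X Y"
proof -
  obtain a b c e where X: "X = (a, b, c, e)" by (cases X)
  obtain a' b' c' e' where Y: "Y = (a', b', c', e')" by (cases Y)
  define \<sigma> where "\<sigma> = dual_sign n"
  have \<sigma>: "\<sigma> = 1 \<or> \<sigma> = -1" using dual_sign_cases[of n] by (auto simp: \<sigma>_def)
  define \<alpha> \<beta> \<gamma> \<delta> where defs: "\<alpha> = a' - a" "\<beta> = b' - b" "\<gamma> = c' - c" "\<delta> = e' - e"
  have \<sigma>2: "\<sigma> * k = l \<longleftrightarrow> k = \<sigma> * l" for k l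
    using \<sigma> by auto
  have signs: "- s \<in> {1, -1}" "\<sigma> * s \<in> {1, -1}" "- (\<sigma> * s) \<in> {1, -1}" if "s \<in> {1, -1}" for s :: int
    using \<sigma> that by auto
  have diff: "2 * int n * a' - b' - (2 * int n * a - b) = 2 * int n * \<alpha> - \<beta>"
    "\<sigma> * c' - \<sigma> * c = \<sigma> * \<gamma>"
    "\<sigma> * (2 * int n * c' - e') - \<sigma> * (2 * int n * c - e) = \<sigma> * (2 * int n * \<gamma> - \<delta>)"
    by (simp_all add: defs algebra_simps)
  show ?thesis
    unfolding X Y dual_map.simps quad_step.simps \<sigma>_def[symmetric] diff
    unfolding defs[symmetric] \<sigma>2
  proof (intro iffI; elim bexE disjE conjE)
    fix s t :: int assume st: "s \<in> {1, -1}" "t \<in> {1, -1}"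
    {
      assume "\<alpha> = 0" "2 * int n * \<alpha> - \<beta> = 2 * s" "\<gamma> = \<sigma> * (2 * t)"
        "2 * int n * \<gamma> - \<delta> = \<sigma> * (4 * int n * t)"
      then show "\<exists>s\<in>{1, -1}. \<exists>t\<in>{1, -1}.
          \<alpha> = 0 \<and> \<beta> = 2 * s \<and> \<gamma> = 2 * t \<and> \<delta> = 4 * int 0 * t \<or>
          \<alpha> = 2 * s \<and> \<beta> = 4 * int 0 * s \<and> \<gamma> = 0 \<and> \<delta> = 2 * t"
        using signs[OF st(1)] signs[OF st(2)]
        by (intro bexI[of _ "- s"] bexI[of _ "\<sigma> * t"] disjI1) simp_all
    next
      assume "\<alpha> = 2 * s" "2 * int n * \<alpha> - \<beta> = 4 * int n * s" "\<gamma> = \<sigma> * 0"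
        "2 * int n * \<gamma> - \<delta> = \<sigma> * (2 * t)"
      then show "\<exists>s\<in>{1, -1}. \<exists>t\<in>{1, -1}.
          \<alpha> = 0 \<and> \<beta> = 2 * s \<and> \<gamma> = 2 * t \<and> \<delta> = 4 * int 0 * t \<or>
          \<alpha> = 2 * s \<and> \<beta> = 4 * int 0 * s \<and> \<gamma> = 0 \<and> \<delta> = 2 * t"
        using signs[OF st(2)] st(1)
        by (intro bexI[of _ s] bexI[of _ "- (\<sigma> * t)"] disjI2) simp_all
    next
      assume "\<alpha> = 0" "\<beta> = 2 * s" "\<gamma> = 2 * t" "\<delta> = 4 * int 0 * t"
      then show "\<exists>s\<in>{1, -1}. \<exists>t\<in>{1, -1}.
          \<alpha> = 0 \<and> 2 * int n * \<alpha> - \<beta> = 2 * s \<and> \<gamma> = \<sigma> * (2 * t) \<and>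
            2 * int n * \<gamma> - \<delta> = \<sigma> * (4 * int n * t) \<or>
          \<alpha> = 2 * s \<and> 2 * int n * \<alpha> - \<beta> = 4 * int n * s \<and> \<gamma> = \<sigma> * 0 \<and>
            2 * int n * \<gamma> - \<delta> = \<sigma> * (2 * t)"
        using signs[OF st(1)] signs[OF st(2)] \<sigma>
        by (intro bexI[of _ "- s"] bexI[of _ "\<sigma> * t"] disjI1) auto
    next
      assume "\<alpha> = 2 * s" "\<beta> = 4 * int 0 * s" "\<gamma> = 0" "\<delta> = 2 * t"
      then show "\<exists>s\<in>{1, -1}. \<exists>t\<in>{1, -1}.
          \<alpha> = 0 \<and> 2 * int n * \<alpha> - \<beta> = 2 * s \<and> \<gamma> = \<sigma> * (2 * t) \<and>
            2 * int n * \<gamma> - \<delta> = \<sigma> * (4 * int n * t) \<or>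
          \<alpha> = 2 * s \<and> 2 * int n * \<alpha> - \<beta> = 4 * int n * s \<and> \<gamma> = \<sigma> * 0 \<and>
            2 * int n * \<gamma> - \<delta> = \<sigma> * (2 * t)"
        using signs[OF st(2)] st(1) \<sigma>
        by (intro bexI[of _ s] bexI[of _ "- (\<sigma> * t)"] disjI2) auto
    }
  qed
qed

section \<open>Connectedness\<close>

text \<open>Coordinates in the wing \<open>(a, c)\<close>: with the notation of \<^const>\<open>quads\<close>,
  \<open>a * b + c * e = 4 * u\<close> and \<open>a * e - c * b = 4 * v - 2\<close>.\<close>

fun wing_quad :: "int \<Rightarrow> int \<Rightarrow> int \<Rightarrow> int \<Rightarrow> quad" where
  "wing_quad a c u v = (a, 2 * a * u - c * (2 * v - 1), c, 2 * c * u + a * (2 * v - 1))"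

text \<open>The graph of \<open>L\<close> in terms of quadruples.\<close>

definition quad_arcs :: "nat \<Rightarrow> nat \<Rightarrow> quad rel" where
  "quad_arcs n d = {(X, Y). X \<in> quads n d \<and> Y \<in> quads n d \<and> quad_step 0 X Y}"

text \<open>The range of the coordinates; the parity condition is the congruence modulo \<open>4\<close> in
  \<^const>\<open>quads\<close>.\<close>

definition wing_coords :: "nat \<Rightarrow> nat \<Rightarrow> int \<Rightarrow> int \<Rightarrow> int \<Rightarrow> int \<Rightarrow> bool" where
  "wing_coords n d a c u v \<longleftrightarrow> a \<in> {1, -1} \<and> c \<in> {1, -1} \<and> even (u - v) \<and>
     - int d \<le> u \<and> u \<le> int n + int d \<and> 1 - int n - int d \<le> v \<and> v \<le> int n + int d"

lemma wing_quad_in_quads: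
  assumes "wing_coords n d a c u v"
  shows "wing_quad a c u v \<in> quads n d"
proof -
  have ac: "a = 1 \<or> a = -1" "c = 1 \<or> c = -1" and ev: "even (u - v)"
    and uv: "- int d \<le> u" "u \<le> int n + int d" "1 - int n - int d \<le> v" "v \<le> int n + int d"
    using assms by (simp_all add: wing_coords_def)
  have "a * (2 * a * u - c * (2 * v - 1)) + c * (2 * c * u + a * (2 * v - 1)) = 4 * u"
    and "a * (2 * c * u + a * (2 * v - 1)) - c * (2 * a * u - c * (2 * v - 1)) = 4 * v - 2"
    using ac by auto
  moreover have "4 dvd 2 * a * u - c * (2 * v - 1) - c" "4 dvd 2 * c * u + a * (2 * v - 1) + a"
    using ac ev by (elim disjE; simp; presburger)+
  ultimately show ?thesis
    using ac uv by (simp add: quads_def)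
qed

lemma quads_wing_coords:
  assumes "X \<in> quads n d"
  obtains a c u v where "wing_coords n d a c u v" and "X = wing_quad a c u v"
proof -
  obtain a b c e where X: "X = (a, b, c, e)" by (cases X)
  obtain k where k: "b = c + 4 * k"
    using assms by (auto simp: X quads_def dvd_def algebra_simps)
  obtain l where l: "e = 4 * l - a"
    using assms by (auto simp: X quads_def dvd_def algebra_simps)
  have ac: "a = 1 \<or> a = -1" "c = 1 \<or> c = -1"
    using assms by (auto simp: X quads_def)
  have "wing_coords n d a c (a * k + c * l) (a * l - c * k)
    \<and> X = wing_quad a c (a * k + c * l) (a * l - c * k)"
    using assms ac by (auto simp: X k l wing_coords_def quads_def)
  then show ?thesis using that by blast
qed

lemma even_nonneg_offset:
  fixes x :: int
  assumes "even x" and "0 \<le> x"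
  obtains k where "x = 2 * int k"
  using assms by (metis evenE nonneg_int_cases zero_le_mult_iff zero_less_numeral not_numeral_le_zero)

locale pinwheel_params =
  fixes n d :: nat
  assumes n_pos: "0 < n" and d_pos: "0 < d"
begin

text \<open>Two quadruples that a walk of \<open>L\<close> connects. A square \<open>(u, v)\<close> of a wing is adjacent to \<open>(v, - u)\<close>
  and \<open>(v - 1, 1 - u)\<close> in the next wing, whenever these are inside the board.\<close>

abbreviation linked :: "quad \<Rightarrow> quad \<Rightarrow> bool"  (infix "\<leftrightarrow>" 50) where
  "X \<leftrightarrow> Y \<equiv> (X, Y) \<in> (quad_arcs n d)\<^sup>*"

lemma linked_sym: "X \<leftrightarrow> Y \<Longrightarrow> Y \<leftrightarrow> X"
proof -
  have "sym (quad_arcs n d)"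
    unfolding sym_def quad_arcs_def using quad_step_0_commute by blast
  then show "X \<leftrightarrow> Y \<Longrightarrow> Y \<leftrightarrow> X"
    by (meson sym_rtrancl symD)
qed

lemma linked_trans: "X \<leftrightarrow> Y \<Longrightarrow> Y \<leftrightarrow> Z \<Longrightarrow> X \<leftrightarrow> Z"
  by (rule rtrancl_trans)

lemma next_wing:
  assumes "wing_coords n d a c u v" and "wing_coords n d (- c) a v (- u)"
  shows "wing_quad a c u v \<leftrightarrow> wing_quad (- c) a v (- u)"
proof -
  have "quad_step 0 (wing_quad a c u v) (wing_quad (- c) a v (- u))"
    using assms(1) unfolding wing_coords_def wing_quad.simps quad_step.simps
    by (elim conjE insertE emptyE; simp)
  then show ?thesis
    using assms
    by (intro r_into_rtrancl) (simp add: quad_arcs_def wing_quad_in_quads del: wing_quad.simps)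
qed

lemma next_wing':
  assumes "wing_coords n d a c u v" and "wing_coords n d (- c) a (v - 1) (1 - u)"
  shows "wing_quad a c u v \<leftrightarrow> wing_quad (- c) a (v - 1) (1 - u)"
proof -
  have "quad_step 0 (wing_quad a c u v) (wing_quad (- c) a (v - 1) (1 - u))"
    using assms(1) unfolding wing_coords_def wing_quad.simps quad_step.simps
    by (elim conjE insertE emptyE; simp)
  then show ?thesis
    using assms
    by (intro r_into_rtrancl) (simp add: quad_arcs_def wing_quad_in_quads del: wing_quad.simps)
qed

text \<open>Two moves, through the next wing here and through the preceding wing in \<open>anti_down\<close>, decrease
  \<open>u\<close> by one. As \<open>d > 0\<close>, at least one of the two detours is possible whenever \<open>u > - d\<close>.\<close>

lemma diag_down:
  assumes "wing_coords n d a c u v" and "1 - int d \<le> v" and "1 - int d \<le> u"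
  shows "wing_quad a c u v \<leftrightarrow> wing_quad a c (u - 1) (v - 1)"
    and "wing_coords n d a c (u - 1) (v - 1)"
proof -
  have w: "wing_coords n d (- c) a (v - 1) (1 - u)"
    using assms n_pos by (auto simp: wing_coords_def)
  show w': "wing_coords n d a c (u - 1) (v - 1)"
    using assms n_pos by (auto simp: wing_coords_def)
  have "wing_quad a c (u - 1) (v - 1) \<leftrightarrow> wing_quad (- c) a (v - 1) (1 - u)"
    using next_wing[OF w'] w by (simp del: wing_quad.simps)
  with next_wing'[OF assms(1) w] show "wing_quad a c u v \<leftrightarrow> wing_quad a c (u - 1) (v - 1)"
    by (blast intro: linked_trans linked_sym)
qed

lemma prev_wing:
  assumes "wing_coords n d a c u v" and "v \<le> int d"
  shows "wing_quad a c u v \<leftrightarrow> wing_quad c (- a) (- v) u"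
    and "wing_coords n d c (- a) (- v) u"
proof -
  show w: "wing_coords n d c (- a) (- v) u"
    using assms n_pos by (auto simp: wing_coords_def)
  show "wing_quad a c u v \<leftrightarrow> wing_quad c (- a) (- v) u"
    using next_wing[OF w] assms(1) by (simp add: linked_sym del: wing_quad.simps)
qed

lemma anti_down:
  assumes "wing_coords n d a c u v" and "v \<le> int d" and "1 - int d \<le> u"
  shows "wing_quad a c u v \<leftrightarrow> wing_quad a c (u - 1) (v + 1)"
    and "wing_coords n d a c (u - 1) (v + 1)"
proof -
  note w = prev_wing[OF assms(1,2)]
  show w': "wing_coords n d a c (u - 1) (v + 1)"
    using assms n_pos by (auto simp: wing_coords_def)
  have "wing_quad c (- a) (- v) u \<leftrightarrow> wing_quad a c (u - 1) (v + 1)"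
    using next_wing'[OF w(2)] w' by (simp add: add.commute del: wing_quad.simps)
  with w(1) show "wing_quad a c u v \<leftrightarrow> wing_quad a c (u - 1) (v + 1)"
    by (rule linked_trans)
qed

lemma to_inner_edge:
  assumes "wing_coords n d a c u v"
  shows "\<exists>v'. wing_coords n d a c (- int d) v' \<and> wing_quad a c u v \<leftrightarrow> wing_quad a c (- int d) v'"
  using assms
proof (induction "nat (u + int d)" arbitrary: u v)
  case 0
  then have "u = - int d" by (auto simp: wing_coords_def)
  then show ?case using 0 by blast
next
  case (Suc k)
  have k: "k = nat (u - 1 + int d)" and u: "1 - int d \<le> u" using Suc.hyps(2) by linarith+
  have "1 - int d \<le> v \<or> v \<le> int d" using d_pos by linarith
  then obtain v'' where "wing_quad a c u v \<leftrightarrow> wing_quad a c (u - 1) v''"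
    and "wing_coords n d a c (u - 1) v''"
    using diag_down[OF Suc.prems _ u] anti_down[OF Suc.prems _ u] by blast
  then show ?case
    using Suc.hyps(1)[OF k, of v''] by (blast intro: linked_trans)
qed

lemma two_down:
  assumes "wing_coords n d a c u v" and "- int d \<le> v" and "v \<le> int d + 1" and "2 - int d \<le> u"
  shows "wing_quad a c u v \<leftrightarrow> wing_quad a c (u - 2) v"
    and "wing_coords n d a c (u - 2) v"
proof -
  show "wing_coords n d a c (u - 2) v"
    using assms by (auto simp: wing_coords_def)
  have u: "1 - int d \<le> u" "1 - int d \<le> u - 1" using assms(4) by simp_all
  show "wing_quad a c u v \<leftrightarrow> wing_quad a c (u - 2) v"
  proof (cases "v \<le> int d")
    case True
    note w = anti_down[OF assms(1) True u(1)]
    show ?thesis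
      using linked_trans[OF w(1) diag_down(1)[OF w(2) _ u(2)]] assms(2)
      by (simp del: wing_quad.simps)
  next
    case False
    then have v: "1 - int d \<le> v" using d_pos by simp
    note w = diag_down[OF assms(1) v u(1)]
    show ?thesis
      using linked_trans[OF w(1) anti_down(1)[OF w(2) _ u(2)]] assms(3)
      by (simp del: wing_quad.simps)
  qed
qed

lemma slide_down:
  assumes "wing_coords n d a c (w + 2 * int k) v" and "- int d \<le> v" and "v \<le> int d + 1"
    and "- int d \<le> w"
  shows "wing_quad a c (w + 2 * int k) v \<leftrightarrow> wing_quad a c w v"
    and "wing_coords n d a c w v"
  using assms(1)
proof (induction k)
  case 0
  {
    case 1
    then show ?case by (simp del: wing_quad.simps)
  next
    case 2
    then show ?case by simp
  }
next
  case (Suc k)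
  have *: "wing_quad a c (w + 2 * int (Suc k)) v \<leftrightarrow> wing_quad a c (w + 2 * int k) v"
    "wing_coords n d a c (w + 2 * int k) v" if "wing_coords n d a c (w + 2 * int (Suc k)) v"
    using two_down[OF that assms(2,3)] assms(4) by (simp_all del: wing_quad.simps)
  {
    case 1
    then show ?case using * Suc.IH(1) linked_trans by blast
  next
    case 2
    then show ?case using *(2) Suc.IH(2) by blast
  }
qed

text \<open>From the edge \<open>u = - d\<close> of a wing one reaches the corner \<open>(- d, - d)\<close> of the preceding wing when
  \<open>v \<le> d\<close>, and the square \<open>(- d, d)\<close> of the next wing when \<open>v > - d\<close>.\<close>

lemma inner_corner_prev:
  assumes "wing_coords n d a c (- int d) v" and "v \<le> int d"
  shows "wing_quad a c (- int d) v \<leftrightarrow> wing_quad c (- a) (- int d) (- int d)"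
    and "wing_coords n d c (- a) (- int d) (- int d)"
proof -
  note w = prev_wing[OF assms]
  have "even (int d - v)" "0 \<le> int d - v" using assms by (auto simp: wing_coords_def)
  then obtain k where "int d - v = 2 * int k"
    by (rule even_nonneg_offset)
  then have k: "- v = - int d + 2 * int k"
    by simp
  show "wing_quad a c (- int d) v \<leftrightarrow> wing_quad c (- a) (- int d) (- int d)"
    using linked_trans[OF w(1)] slide_down(1)[OF w(2)[unfolded k]] k by simp
  show "wing_coords n d c (- a) (- int d) (- int d)"
    using slide_down(2)[OF w(2)[unfolded k]] by simp
qed

lemma inner_corner_next:
  assumes "wing_coords n d a c (- int d) v" and "1 - int d \<le> v"
  shows "wing_quad a c (- int d) v \<leftrightarrow> wing_quad (- c) a (- int d) (int d)"
    and "wing_coords n d (- c) a (- int d) (int d)"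
proof -
  have w: "wing_coords n d (- c) a (v - 1) (1 + int d)"
    using assms n_pos by (auto simp: wing_coords_def)
  have step: "wing_quad a c (- int d) v \<leftrightarrow> wing_quad (- c) a (v - 1) (1 + int d)"
    using next_wing'[OF assms(1)] w by (simp del: wing_quad.simps)
  \<comment> \<open>\<open>v\<close> and \<open>d\<close> have the same parity, so \<open>v > - d\<close> improves to \<open>v \<ge> 2 - d\<close>\<close>
  have "even (- int d - v)" using assms(1) by (simp only: wing_coords_def)
  then have "even (v + int d - 2)" "0 \<le> v + int d - 2" using assms(2) by presburger+
  then obtain k where "v + int d - 2 = 2 * int k"
    by (rule even_nonneg_offset)
  then have k: "v - 1 = (1 - int d) + 2 * int k"
    by simp
  have slide: "wing_quad (- c) a (v - 1) (1 + int d) \<leftrightarrow> wing_quad (- c) a (1 - int d) (1 + int d)"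
    and w': "wing_coords n d (- c) a (1 - int d) (1 + int d)"
    using slide_down[OF w[unfolded k]] d_pos unfolding k by (simp_all del: wing_quad.simps)
  have "wing_quad (- c) a (1 - int d) (1 + int d) \<leftrightarrow> wing_quad (- c) a (- int d) (int d)"
    and "wing_coords n d (- c) a (- int d) (int d)"
    using diag_down[OF w'] by (simp_all del: wing_quad.simps)
  then show "wing_quad a c (- int d) v \<leftrightarrow> wing_quad (- c) a (- int d) (int d)"
    and "wing_coords n d (- c) a (- int d) (int d)"
    using linked_trans[OF step] linked_trans[OF slide] by blast+
qed

lemma quads_linked:
  assumes "X \<in> quads n d" and "Y \<in> quads n d"
  shows "X \<leftrightarrow> Y"
proof -
  define corner where "corner a c = wing_quad a c (- int d) (- int d)" for a c
  have corner_step: "corner a c \<leftrightarrow> corner c (- a)" if "a \<in> {1, -1}" "c \<in> {1, -1}" for a c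
    using inner_corner_prev(1)[of a c "- int d"] that n_pos
    by (simp add: corner_def wing_coords_def del: wing_quad.simps)
  have "corner 1 (-1) \<leftrightarrow> corner 1 1" "corner (-1) (-1) \<leftrightarrow> corner 1 (-1)" "corner (-1) 1 \<leftrightarrow> corner 1 1"
    using corner_step[of 1 1] corner_step[of 1 "-1"] corner_step[of "-1" 1] by (simp_all add: linked_sym)
  then have corner_linked: "corner a c \<leftrightarrow> corner 1 1" if "a \<in> {1, -1}" "c \<in> {1, -1}" for a c
    using that linked_trans[of "corner (-1) (-1)" "corner 1 (-1)" "corner 1 1"] by auto
  have "Z \<leftrightarrow> corner 1 1" if Z: "Z \<in> quads n d" for Z
  proof -
    obtain a c u v where w: "wing_coords n d a c u v" and Z': "Z = wing_quad a c u v"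
      using quads_wing_coords[OF Z] .
    then have ac: "a \<in> {1, -1}" "c \<in> {1, -1}" "- a \<in> {1, -1}" by (auto simp: wing_coords_def)
    obtain v' where v': "wing_coords n d a c (- int d) v'" and *: "Z \<leftrightarrow> wing_quad a c (- int d) v'"
      using to_inner_edge[OF w] unfolding Z' by blast
    show ?thesis
    proof (cases "v' \<le> int d")
      case True
      then have "wing_quad a c (- int d) v' \<leftrightarrow> corner c (- a)"
        using inner_corner_prev(1)[OF v'] by (simp add: corner_def del: wing_quad.simps)
      then show ?thesis
        using * corner_linked[OF ac(2,3)] by (blast intro: linked_trans)
    next
      case False
      then have "1 - int d \<le> v'" by simp
      note next' = inner_corner_next[OF v' this]
      have "wing_quad (- c) a (- int d) (int d) \<leftrightarrow> corner a c"
        using inner_corner_prev(1)[OF next'(2)] by (simp add: corner_def del: wing_quad.simps)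
      then show ?thesis
        using * next'(1) corner_linked[OF ac(1,2)] by (blast intro: linked_trans)
    qed
  qed
  then show ?thesis
    using assms by (blast intro: linked_trans linked_sym)
qed

end

section \<open>Squares of the expanded pinwheel board\<close>

lemma rcong_iff: "[x = y] (rmod m) \<longleftrightarrow> (\<exists>k. x = y + of_int k * m)"
  unfolding rcong_altdef[of y x m, symmetric] by (rule rcong_sym_iff)

text \<open>The quadruples of the wing with first column \<open>(a, c)\<close>.\<close>

definition quads_of_wing :: "nat \<Rightarrow> nat \<Rightarrow> int \<Rightarrow> int \<Rightarrow> quad set" where
  "quads_of_wing n d a c = {X \<in> quads n d. fst X = a \<and> fst (snd (snd X)) = c}"

lemma rot90_square_at: "rot90 (square_at p q (a, b, c, e)) = square_at p q (- c, - e, a, b)"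
  by (simp add: rot90_def square_at_simps vec2_eq_iff field_simps)

text \<open>Rotation permutes the wings cyclically.\<close>

lemma rot90_wing:
  "rot90 ` square_at p q ` quads_of_wing n d a c = square_at p q ` quads_of_wing n d (- c) a"
proof (intro equalityI subsetI; elim imageE)
  fix x Y X assume x: "x = rot90 Y" "Y = square_at p q X" and X: "X \<in> quads_of_wing n d a c"
  obtain b e where X': "X = (a, b, c, e)" using X by (cases X) (auto simp: quads_of_wing_def)
  have "4 dvd e + a"
    using X by (simp add: X' quads_of_wing_def quads_def)
  then have "4 dvd - e - a"
    by presburger
  then have "(- c, - e, a, b) \<in> quads_of_wing n d (- c) a"
    using X by (auto simp: X' quads_of_wing_def quads_def algebra_simps)
  then show "x \<in> square_at p q ` quads_of_wing n d (- c) a"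
    unfolding x X' rot90_square_at by (rule imageI)
next
  fix x Y assume x: "x = square_at p q Y" and Y: "Y \<in> quads_of_wing n d (- c) a"
  obtain e' b where "Y = (- c, e', a, b)"
    using Y by (cases Y) (auto simp: quads_of_wing_def)
  moreover define e where "e = - e'"
  ultimately have Y': "Y = (- c, - e, a, b)"
    by simp
  have "4 dvd - e - a"
    using Y by (simp add: Y' quads_of_wing_def quads_def)
  then have "4 dvd e + a"
    by presburger
  then have "(a, b, c, e) \<in> quads_of_wing n d a c"
    using Y by (auto simp: Y' quads_of_wing_def quads_def algebra_simps)
  then show "x \<in> rot90 ` square_at p q ` quads_of_wing n d a c"
    unfolding x Y' rot90_square_at[symmetric] by (intro imageI)
qed

lemma pinwheel_wing_eq:
  assumes "0 < q"
  shows "pinwheel_wing n d p q = square_at p q ` quads_of_wing n d 1 1"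
proof (intro equalityI subsetI)
  fix x assume x: "x \<in> pinwheel_wing n d p q"
  then obtain k l :: int where x1: "x $ 1 = (real p + real q) / 2 + of_int k * (2 * real q)"
    and x2: "x $ 2 = (real p - real q) / 2 + of_int l * (2 * real q)"
    using assms by (auto simp: pinwheel_wing_def pinwheel_net_def rcong_iff)
  have sum: "x $ 1 + x $ 2 = real p + of_int (2 * (k + l)) * real q"
    and diff: "x $ 2 - x $ 1 = of_int (2 * (l - k) - 1) * real q"
    by (simp_all add: x1 x2 field_simps)
  have "- (2 * int d) * real q \<le> of_int (2 * (k + l)) * real q"
    "of_int (2 * (k + l)) * real q \<le> of_int (2 * (int n + int d)) * real q"
    "of_int (- (2 * int n + 2 * int d - 1)) * real q \<le> of_int (2 * (l - k) - 1) * real q"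
    "of_int (2 * (l - k) - 1) * real q \<le> of_int (2 * int n + 2 * int d - 1) * real q"
    using x unfolding pinwheel_wing_def mem_Collect_eq sum diff by (simp_all add: algebra_simps)
  then have "- (2 * int d) \<le> 2 * (k + l)" "2 * (k + l) \<le> 2 * (int n + int d)"
    "- (2 * int n + 2 * int d - 1) \<le> 2 * (l - k) - 1" "2 * (l - k) - 1 \<le> 2 * int n + 2 * int d - 1"
    using assms by (simp_all only: mult_le_cancel_right of_int_le_iff)
  then have "(1, 1 + 4 * k, 1, 4 * l - 1) \<in> quads_of_wing n d 1 1"
    by (auto simp: quads_of_wing_def quads_def)
  moreover have "x = square_at p q (1, 1 + 4 * k, 1, 4 * l - 1)"
    by (simp add: square_at_simps vec_eq_iff forall_2 x1 x2 field_simps)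
  ultimately show "x \<in> square_at p q ` quads_of_wing n d 1 1"
    by blast
next
  fix x assume "x \<in> square_at p q ` quads_of_wing n d 1 1"
  then obtain X where X: "X \<in> quads_of_wing n d 1 1" and x: "x = square_at p q X"
    by blast
  obtain b e where X': "X = (1, b, 1, e)" using X by (cases X) (auto simp: quads_of_wing_def)
  have dvd: "4 dvd b - 1" "4 dvd e + 1" using X by (simp_all add: X' quads_of_wing_def quads_def)
  obtain k where b: "b = 1 + 4 * k" using dvd(1) by (metis add.commute diff_add_cancel dvdE)
  obtain l where e: "e = 4 * l - 1" using dvd(2) by (metis add_diff_cancel_right' dvdE)
  have x1: "x $ 1 = (real p + real q) / 2 + of_int k * (2 * real q)"
    and x2: "x $ 2 = (real p - real q) / 2 + of_int l * (2 * real q)"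
    by (simp_all add: x X' b e square_at_simps field_simps)
  have sum: "x $ 1 + x $ 2 = real p + of_int (2 * (k + l)) * real q"
    and diff: "x $ 2 - x $ 1 = of_int (2 * (l - k) - 1) * real q"
    by (simp_all add: x1 x2 field_simps)
  have "- (2 * int d) \<le> 2 * (k + l)" "2 * (k + l) \<le> 2 * (int n + int d)"
    "- (2 * int n + 2 * int d - 1) \<le> 2 * (l - k) - 1" "2 * (l - k) - 1 \<le> 2 * int n + 2 * int d - 1"
    using X by (auto simp: X' b e quads_of_wing_def quads_def)
  then have "of_int (- (2 * int d)) * real q \<le> of_int (2 * (k + l)) * real q"
    "of_int (2 * (k + l)) * real q \<le> of_int (2 * (int n + int d)) * real q"
    "of_int (- (2 * int n + 2 * int d - 1)) * real q \<le> of_int (2 * (l - k) - 1) * real q"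
    "of_int (2 * (l - k) - 1) * real q \<le> of_int (2 * int n + 2 * int d - 1) * real q"
    by (intro mult_right_mono; simp only: of_int_le_iff of_nat_0_le_iff)+
  moreover have "x \<in> pinwheel_net p q"
    using assms x1 x2 by (auto simp: pinwheel_net_def rcong_iff)
  ultimately show "x \<in> pinwheel_wing n d p q"
    unfolding pinwheel_wing_def mem_Collect_eq sum diff by (simp add: algebra_simps)
qed

lemma expanded_pinwheel_eq:
  assumes "0 < q"
  shows "expanded_pinwheel n d p q = square_at p q ` quads n d"
proof -
  define W where "W a c = square_at p q ` quads_of_wing n d a c" for a c
  have rot: "rot90 ` W a c = W (- c) a" for a c
    unfolding W_def by (rule rot90_wing)
  have pow: "(rot90 ^^ 0) ` S = S" "(rot90 ^^ Suc k) ` S = rot90 ` (rot90 ^^ k) ` S" for k S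
    by (simp_all add: image_comp)
  have "{..<4} = {0, 1, 2, 3 :: nat}" by auto
  moreover have "(rot90 ^^ 0) ` W 1 1 = W 1 1" "(rot90 ^^ 1) ` W 1 1 = W (-1) 1"
    "(rot90 ^^ 2) ` W 1 1 = W (-1) (-1)" "(rot90 ^^ 3) ` W 1 1 = W 1 (-1)"
    by (simp_all only: numeral_2_eq_2 numeral_3_eq_3 One_nat_def pow rot minus_minus)
  ultimately have "expanded_pinwheel n d p q = W 1 1 \<union> W (-1) 1 \<union> W (-1) (-1) \<union> W 1 (-1)"
    unfolding expanded_pinwheel_def pinwheel_wing_eq[OF assms] W_def[symmetric] by auto
  also have "\<dots> = square_at p q ` quads n d"
    unfolding W_def image_Un[symmetric] by (rule arg_cong[of _ _ "image _"])
      (auto simp: quads_of_wing_def quads_def)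
  finally show ?thesis .
qed

lemma square_at_in_chessboard:
  assumes "X \<in> quads n d"
  shows "square_at p q X \<in> chessboard p q"
proof -
  obtain a b c e where X: "X = (a, b, c, e)" by (cases X)
  have ac: "a = 1 \<or> a = -1" "c = 1 \<or> c = -1" and "4 dvd b - c" "4 dvd e + a"
    using assms by (simp_all add: X quads_def)
  then have "even (a - 1)" "even (c - 1)" "even (b - 1)" "even (e - 1)"
    by (auto; presburger)+
  then obtain i j k l where "a = 2 * i + 1" "b = 2 * j + 1" "c = 2 * k + 1" "e = 2 * l + 1"
    by (metis diff_add_cancel dvdE)
  then have "square_at p q X $ 1 - real (p + q) / 2 = real_of_int (i * int p + j * int q)"
    "square_at p q X $ 2 - real (p + q) / 2 = real_of_int (k * int p + l * int q)"
    by (simp_all add: X square_at_simps field_simps)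
  then show ?thesis
    unfolding chessboard_def mem_Collect_eq forall_2 by (simp only: Ints_of_int simp_thms)
qed

section \<open>Leaper graphs and direction graphs of the board\<close>

lemma leaper_eq: "leaper r s = (\<lambda>A. A *v vector [real r, real s]) ` dir_matrix ` directions"
proof -
  have "{f \<sigma> \<tau> | \<sigma> \<tau>. \<sigma> \<in> {1, -1} \<and> \<tau> \<in> {1, -1}} = {f 1 1, f 1 (-1), f (-1) 1, f (-1) (-1)}"
    for f :: "real \<Rightarrow> real \<Rightarrow> real ^ 2"
    by blast
  then show ?thesis
    unfolding leaper_def dir_matrix_image image_insert image_empty mat2_mult_vec by auto
qed

lemma leaper_commute: "leaper p q = leaper q p"
  unfolding leaper_def by (rule Un_commute)

lemma leaper_pinwheel:
  assumes "(vector [real r, real s] :: real ^ 2) = pinwheel_matrix m *v vector [real p, real q]"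
  shows "leaper r s =
    (\<lambda>A. A *v vector [real p, real q]) ` (\<lambda>A. A ** pinwheel_matrix m) ` dir_matrix ` directions"
  unfolding leaper_eq assms by (simp add: image_image matrix_vector_mul_assoc)

text \<open>This reduces the adjacency of squares, for both leapers, to that of quadruples.\<close>

lemma diff_in_leaper_iff:
  assumes "X \<in> quads n d" "Y \<in> quads n d" "0 < p" "p < q"
    and "(vector [real r, real s] :: real ^ 2) = pinwheel_matrix m *v vector [real p, real q]"
  shows "square_at p q Y - square_at p q X \<in> leaper r s \<longleftrightarrow> quad_step m X Y"
proof
  assume "square_at p q Y - square_at p q X \<in> leaper r s"
  then obtain A where "A \<in> (\<lambda>A. A ** pinwheel_matrix m) ` dir_matrix ` directions"
    "square_at p q Y - square_at p q X = A *v vector [real p, real q]"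
    unfolding leaper_pinwheel[OF assms(5)] by blast
  then show "quad_step m X Y"
    using pinwheel_move_rigid[OF assms(1-4)] by (simp add: quad_step_iff)
next
  assume "quad_step m X Y"
  then show "square_at p q Y - square_at p q X \<in> leaper r s"
    unfolding quad_step_iff leaper_pinwheel[OF assms(5)] square_at_def
      matrix_vector_mult_diff_rdistrib[symmetric] by (rule imageI)
qed

lemma inj_on_dir_matrix: "inj_on dir_matrix directions"
  unfolding directions_eq inj_on_def ball_simps insert_iff
  by (auto simp: dir_matrix_simps[simplified] mat2_eq_iff)

lemma move_direction:
  assumes "X \<in> quads n d" "Y \<in> quads n d" "0 < p" "p < q" and "quad_step 0 X Y"
  shows "move_direction p q (square_at p q Y - square_at p q X) \<in> directions"
    and "dir_matrix (move_direction p q (square_at p q Y - square_at p q X)) =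
      half_matrix Y - half_matrix X"
proof -
  obtain i where i: "i \<in> directions" "half_matrix Y - half_matrix X = dir_matrix i"
    using assms(5) unfolding quad_step_0_iff by blast
  have "move_direction p q (square_at p q Y - square_at p q X) = i"
    unfolding move_direction_def
  proof (rule the_equality)
    show "i \<in> directions \<and> square_at p q Y - square_at p q X = dir_matrix i *v vector [real p, real q]"
      using i by (simp add: square_at_def matrix_vector_mult_diff_rdistrib[symmetric])
  next
    fix j assume j: "j \<in> directions \<and>
      square_at p q Y - square_at p q X = dir_matrix j *v vector [real p, real q]"
    then have "half_matrix Y - half_matrix X = dir_matrix j"
      using pinwheel_move_rigid[OF assms(1-4), of "dir_matrix j" 0]
      by (simp add: dir_matrix_image_pinwheel_0)
    then show "j = i"
      using i j inj_onD[OF inj_on_dir_matrix] by metis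
  qed
  then show "move_direction p q (square_at p q Y - square_at p q X) \<in> directions"
    and "dir_matrix (move_direction p q (square_at p q Y - square_at p q X)) =
      half_matrix Y - half_matrix X"
    using i by simp_all
qed

section \<open>The quarter turn of positions\<close>

text \<open>The map \<open>A \<mapsto> S ** A ** J\<close>, with \<open>S\<close> as in \<^const>\<open>dual_map\<close> and \<open>J\<close> a quarter turn. It permutes the
  direction matrices, and \<open>dual_turn n X ** pinwheel_matrix n\<close> is the image of \<open>X\<close> under the duality
  map. Thus \<open>dual_turn n\<close> turns the positions of the extracted graph into positions of its
  complement.\<close>

definition dual_turn :: "nat \<Rightarrow> real ^ 2 ^ 2 \<Rightarrow> real ^ 2 ^ 2" where
  "dual_turn n A = mat2 1 0 0 (real_of_int (dual_sign n)) ** A ** mat2 0 1 (-1) 0"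

text \<open>The permutation of directions that \<^const>\<open>dual_turn\<close> induces.\<close>

definition dual_perm :: "nat \<Rightarrow> nat \<Rightarrow> nat" where
  "dual_perm n = (if odd n then pi_pinwheel else pi_reflect \<circ> pi_pinwheel)"

lemma dual_turn_mat2:
  "dual_turn n (mat2 a b c e) =
     mat2 (- b) a (- (real_of_int (dual_sign n) * e)) (real_of_int (dual_sign n) * c)"
  by (simp add: dual_turn_def mat2_mult)

lemma mat2_cases: obtains a b c e where "A = mat2 a b c e"
  by (metis mat2_eq_iff)

lemma dual_turn_diff: "dual_turn n (A - B) = dual_turn n A - dual_turn n B"
proof -
  obtain a b c e a' b' c' e' where "A = mat2 a b c e" "B = mat2 a' b' c' e'"
    by (metis mat2_cases)
  then show ?thesis
    by (simp only: dual_turn_mat2 mat2_diff) (simp add: algebra_simps)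
qed

lemma dual_turn_twice: "dual_turn n (dual_turn n A) = - A"
proof -
  obtain a b c e where "A = mat2 a b c e"
    by (rule mat2_cases)
  moreover have "real_of_int (dual_sign n) * real_of_int (dual_sign n) = 1"
    by (simp add: dual_sign_def)
  ultimately show ?thesis
    by (simp add: dual_turn_mat2 uminus_mat2 mult.assoc[symmetric])
qed

lemma dual_turn_dir_matrix:
  assumes "i \<in> directions"
  shows "dual_perm n i \<in> directions"
    and "dual_turn n (dir_matrix i) = dir_matrix (dual_perm n i)"
  using assms dual_sign_cases[of n] unfolding directions_eq
  by (auto simp: dual_perm_def pi_pinwheel_def pi_reflect_def dir_matrix_simps[simplified]
      dual_turn_mat2 mat2_eq_iff)

lemma dual_turn_in_dir_matrices:
  "dual_turn n A \<in> dir_matrix ` directions \<longleftrightarrow> A \<in> dir_matrix ` directions"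
proof
  assume "A \<in> dir_matrix ` directions"
  then show "dual_turn n A \<in> dir_matrix ` directions"
    using dual_turn_dir_matrix by auto
next
  assume "dual_turn n A \<in> dir_matrix ` directions"
  then have "dual_turn n (dual_turn n A) \<in> dir_matrix ` directions"
    using dual_turn_dir_matrix by fastforce
  then show "A \<in> dir_matrix ` directions"
    using uminus_dir_matrix[of "- A"] by (simp add: dual_turn_twice)
qed

lemma dual_turn_pinwheel:
  "dual_turn n (half_matrix X) ** pinwheel_matrix n = half_matrix (dual_map n X)"
  by (cases X) (simp add: dual_turn_mat2 pinwheel_matrix_def mat2_mult mat2_eq_iff field_simps)

lemma inj_dual_turn: "inj (dual_turn n)"
  by (rule injI) (metis dual_turn_twice minus_equation_iff)

lemma matrix_diff_mult: "(A - B) ** C = A ** C - B ** C"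
  for A B :: "'a :: ring_1 ^ 'n ^ 'm" and C :: "'a ^ 'k ^ 'n"
  by (simp add: vec_eq_iff matrix_matrix_mult_def algebra_simps sum_subtractf)

section \<open>Duality of the expanded pinwheel board\<close>

lemma pverts_leaper_graph [simp]: "pverts (leaper_graph L B) = B"
  by (simp add: leaper_graph_def)

lemma parcs_leaper_graph: "parcs (leaper_graph L B) \<subseteq> pverts (leaper_graph L B) \<times> pverts (leaper_graph L B)"
  by (auto simp: leaper_graph_def)

text \<open>The board of a \<open>(p,q)\<close>-leaper, with \<open>coord\<close> assigning to each square its quadruple.\<close>

locale pinwheel_board = pinwheel_params +
  fixes p q :: nat
  assumes p_pos: "0 < p" and p_less: "p < q"
begin

abbreviation board :: "square set" where
  "board \<equiv> expanded_pinwheel n d p q"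

definition coord :: "square \<Rightarrow> quad" where
  "coord = the_inv_into (quads n d) (square_at p q)"

lemma board_eq: "board = square_at p q ` quads n d"
  using p_less by (intro expanded_pinwheel_eq) simp

lemma bij_square_at: "bij_betw (square_at p q) (quads n d) board"
  using inj_on_square_at[OF p_pos p_less] by (simp add: bij_betw_def board_eq)

lemma square_at_in_board: "X \<in> quads n d \<Longrightarrow> square_at p q X \<in> board"
  by (simp add: board_eq)

lemma bij_coord: "bij_betw coord board (quads n d)"
  unfolding coord_def by (rule bij_betw_the_inv_into[OF bij_square_at])

lemma coord_in: "x \<in> board \<Longrightarrow> coord x \<in> quads n d"
  using bij_coord by (auto simp: bij_betw_def)

lemma square_at_coord: "x \<in> board \<Longrightarrow> square_at p q (coord x) = x"
  unfolding coord_def by (rule f_the_inv_into_f_bij_betw[OF bij_square_at])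

lemma coord_square_at: "X \<in> quads n d \<Longrightarrow> coord (square_at p q X) = X"
  unfolding coord_def by (rule the_inv_into_f_f[OF inj_on_square_at[OF p_pos p_less]])

lemma arc_iff_quad_step:
  assumes "(vector [real r, real s] :: real ^ 2) = pinwheel_matrix m *v vector [real p, real q]"
  shows "(x, y) \<in> parcs (leaper_graph (leaper r s) board) \<longleftrightarrow>
    x \<in> board \<and> y \<in> board \<and> quad_step m (coord x) (coord y)"
  using diff_in_leaper_iff[OF coord_in coord_in p_pos p_less assms, of x y]
  by (auto simp: leaper_graph_def square_at_coord)

lemma arc_iff_quad_step_0:
  "(x, y) \<in> parcs (leaper_graph (leaper p q) board) \<longleftrightarrow>
    x \<in> board \<and> y \<in> board \<and> quad_step 0 (coord x) (coord y)"
  unfolding leaper_commute[of p q]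
  by (rule arc_iff_quad_step) (simp add: pinwheel_matrix_def mat2_mult_vec)

lemma quads_witnesses: "(1, 1, 1, -1) \<in> quads n d" "(-1, 1, 1, 1) \<in> quads n d"
  using n_pos d_pos by (simp_all add: quads_def)

text \<open>With \<open>f = square_at p q\<close> this gives connectedness for \<open>L\<close>; composing \<open>f\<close> with the duality map
  gives it for \<open>M\<close>.\<close>

lemma connected_of_quad_arcs:
  assumes "bij_betw f (quads n d) board"
    and "\<And>X Y. (X, Y) \<in> quad_arcs n d \<Longrightarrow> (f X, f Y) \<in> parcs (leaper_graph L board)"
  shows "Digraph_Component.connected (with_proj (leaper_graph L board))"
proof (rule connected_of_rtrancl[OF parcs_leaper_graph])
  show "pverts (leaper_graph L board) \<noteq> {}"
    using quads_witnesses by (auto simp: board_eq)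
next
  fix u v assume "u \<in> pverts (leaper_graph L board)" "v \<in> pverts (leaper_graph L board)"
  then have "u \<in> f ` quads n d" "v \<in> f ` quads n d"
    using assms(1) by (simp_all add: bij_betw_def)
  then obtain X Y where "X \<in> quads n d" "Y \<in> quads n d" "u = f X" "v = f Y"
    by blast
  moreover have "(f X, f Y) \<in> (parcs (leaper_graph L board))\<^sup>*" if "X \<leftrightarrow> Y" for X Y
    using that by (induction rule: rtrancl_induct) (auto intro: assms(2) rtrancl_into_rtrancl)
  ultimately show "(u, v) \<in> (parcs (leaper_graph L board))\<^sup>*"
    using quads_linked by blast
qed

lemma connected_leaper_graph:
  "Digraph_Component.connected (with_proj (leaper_graph (leaper p q) board))"
  by (rule connected_of_quad_arcs[OF bij_square_at])
    (simp add: arc_iff_quad_step_0 quad_arcs_def coord_square_at square_at_in_board)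

text \<open>The duality map, transported from quadruples to squares.\<close>

definition board_dual_map :: "square \<Rightarrow> square" where
  "board_dual_map = square_at p q \<circ> dual_map n \<circ> coord"

lemma bij_board_dual_map: "bij_betw board_dual_map board board"
  unfolding board_dual_map_def
  using bij_betw_trans[OF bij_betw_trans[OF bij_coord bij_dual_map] bij_square_at]
  by (simp add: comp_assoc)

lemma coord_board_dual_map: "x \<in> board \<Longrightarrow> coord (board_dual_map x) = dual_map n (coord x)"
  by (simp add: board_dual_map_def coord_square_at dual_map_in_quads coord_in)

lemma board_dual_map_in: "x \<in> board \<Longrightarrow> board_dual_map x \<in> board"
  using bij_board_dual_map by (auto simp: bij_betw_def)

lemma board_is_dual:
  assumes rs: "(vector [real r, real s] :: real ^ 2) = pinwheel_matrix n *v vector [real p, real q]"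
  shows "dual_board (chessboard p q) board (leaper p q) (leaper r s)"
  unfolding dual_board_def
proof (intro conjI)
  show "board \<subseteq> chessboard p q"
    using square_at_in_chessboard by (auto simp: board_eq)
  have "real s = real p + 2 * real n * real q"
    using rs by (simp add: pinwheel_matrix_def mat2_mult_vec vec2_eq_iff)
  moreover have "1 * real q \<le> 2 * real n * real q"
    using n_pos by (intro mult_right_mono) auto
  ultimately have s: "real p < real s" "real q < real s"
    using p_pos p_less by linarith+
  \<comment> \<open>every move of \<open>M\<close> has a coordinate of absolute value \<open>s\<close>, which exceeds \<open>p\<close> and \<open>q\<close>\<close>
  have "v $ 1 \<in> {real s, - real s} \<or> v $ 2 \<in> {real s, - real s}" if "v \<in> leaper r s" for v
    using that unfolding leaper_def by auto
  moreover have "vector [real p, real q] \<in> leaper p q"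
    unfolding leaper_def by (intro UnI1 CollectI exI[of _ 1]) simp
  ultimately show "leaper p q \<noteq> leaper r s"
    using s by fastforce
  show "\<exists>a\<in>board. \<exists>b\<in>board. a \<noteq> b"
    using quads_witnesses inj_onD[OF inj_on_square_at[OF p_pos p_less, of n d]]
    by (fastforce simp: board_eq)
  show "Digraph_Component.connected (with_proj (leaper_graph (leaper p q) board))"
    by (rule connected_leaper_graph)
  show "Digraph_Component.connected (with_proj (leaper_graph (leaper r s) board))"
  proof (rule connected_of_quad_arcs)
    show "bij_betw (square_at p q \<circ> dual_map n) (quads n d) board"
      by (rule bij_betw_trans[OF bij_dual_map bij_square_at])
  next
    fix X Y assume "(X, Y) \<in> quad_arcs n d"
    then show "((square_at p q \<circ> dual_map n) X, (square_at p q \<circ> dual_map n) Y)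
        \<in> parcs (leaper_graph (leaper r s) board)"
      by (simp add: arc_iff_quad_step[OF rs] quad_arcs_def coord_square_at square_at_in_board
          dual_map_in_quads quad_step_dual_map)
  qed
  have arcs: "(board_dual_map u, board_dual_map v) \<in> parcs (leaper_graph (leaper r s) board) \<longleftrightarrow>
      (u, v) \<in> parcs (leaper_graph (leaper p q) board)"
    if "u \<in> pverts (leaper_graph (leaper p q) board)"
      "v \<in> pverts (leaper_graph (leaper p q) board)" for u v
    using that by (simp add: arc_iff_quad_step_0 arc_iff_quad_step[OF rs]
        board_dual_map_in coord_board_dual_map quad_step_dual_map)
  show "digraph_iso (with_proj (leaper_graph (leaper p q) board))
      (with_proj (leaper_graph (leaper r s) board))"
    using pair_isomorphism[OF parcs_leaper_graph parcs_leaper_graph _ arcs] bij_board_dual_map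
    unfolding digraph_iso_def by fastforce
qed

sublocale extracted: placed_digraph "pinwheel_graph n d p q" "half_matrix \<circ> coord"
proof
  show "inj_on (half_matrix \<circ> coord) (pverts (underlying (pinwheel_graph n d p q)))"
    using bij_betw_imp_inj_on[OF bij_coord] inj_on_subset[OF inj_half_matrix]
    by (simp add: pinwheel_graph_def extracted_graph_def comp_inj_on)
  fix x y
  show arc: "(x, y) \<in> parcs (underlying (pinwheel_graph n d p q)) \<longleftrightarrow>
      x \<in> pverts (underlying (pinwheel_graph n d p q)) \<and>
      y \<in> pverts (underlying (pinwheel_graph n d p q)) \<and>
      (half_matrix \<circ> coord) y - (half_matrix \<circ> coord) x \<in> dir_matrix ` directions"
    by (simp add: pinwheel_graph_def extracted_graph_def arc_iff_quad_step_0 quad_step_0_iff)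
  assume "(x, y) \<in> parcs (underlying (pinwheel_graph n d p q))"
  then have xy: "x \<in> board" "y \<in> board" and "quad_step 0 (coord x) (coord y)"
    by (simp_all add: pinwheel_graph_def extracted_graph_def arc_iff_quad_step_0)
  note move_direction[OF coord_in[OF xy(1)] coord_in[OF xy(2)] p_pos p_less this(3)]
  then show "label (pinwheel_graph n d p q) (x, y) \<in> directions"
    and "dir_matrix (label (pinwheel_graph n d p q) (x, y)) =
      (half_matrix \<circ> coord) y - (half_matrix \<circ> coord) x"
    by (simp_all add: pinwheel_graph_def extracted_graph_def square_at_coord xy)
qed

lemma underlying_pinwheel_graph:
  "underlying (pinwheel_graph n d p q) = leaper_graph (leaper p q) board"
  by (simp add: pinwheel_graph_def extracted_graph_def)

lemma underlying_relabel [simp]: "underlying (relabel \<pi> \<Phi>) = underlying \<Phi>"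
  by (simp add: relabel_def)

lemma label_relabel [simp]: "label (relabel \<pi> \<Phi>) e = \<pi> (label \<Phi> e)"
  by (simp add: relabel_def)

sublocale complement: placed_digraph "relabel (dual_perm n) (pinwheel_graph n d p q)"
  "dual_turn n \<circ> (half_matrix \<circ> coord)"
proof
  show "inj_on (dual_turn n \<circ> (half_matrix \<circ> coord))
      (pverts (underlying (relabel (dual_perm n) (pinwheel_graph n d p q))))"
    using extracted.inj_P inj_on_subset[OF inj_dual_turn] by (simp add: comp_inj_on)
  fix x y
  show "(x, y) \<in> parcs (underlying (relabel (dual_perm n) (pinwheel_graph n d p q))) \<longleftrightarrow>
      x \<in> pverts (underlying (relabel (dual_perm n) (pinwheel_graph n d p q))) \<and>
      y \<in> pverts (underlying (relabel (dual_perm n) (pinwheel_graph n d p q))) \<and>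
      (dual_turn n \<circ> (half_matrix \<circ> coord)) y - (dual_turn n \<circ> (half_matrix \<circ> coord)) x
        \<in> dir_matrix ` directions"
    by (simp add: extracted.arc_iff dual_turn_in_dir_matrices flip: dual_turn_diff)
  assume "(x, y) \<in> parcs (underlying (relabel (dual_perm n) (pinwheel_graph n d p q)))"
  then have e: "(x, y) \<in> parcs (underlying (pinwheel_graph n d p q))"
    by simp
  note dual_turn_dir_matrix[OF extracted.label_in[OF e], of n]
  then show "label (relabel (dual_perm n) (pinwheel_graph n d p q)) (x, y) \<in> directions"
    and "dir_matrix (label (relabel (dual_perm n) (pinwheel_graph n d p q)) (x, y)) =
      (dual_turn n \<circ> (half_matrix \<circ> coord)) y - (dual_turn n \<circ> (half_matrix \<circ> coord)) x"
    using extracted.label_matrix[OF e] by (simp_all flip: dual_turn_diff)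
qed

lemma trivial_board: "trivial_leaper_graph p q board"
proof -
  have "sum_list (map (\<lambda>(a, b). dir_matrix (move_direction p q (b - a))) W) =
      label_sum (pinwheel_graph n d p q) W" for W
    by (simp add: label_sum_def pinwheel_graph_def extracted_graph_def case_prod_unfold)
  then show ?thesis
    unfolding trivial_leaper_graph_def nontrivial_cycle_def
    using extracted.cycle_sum by (simp add: underlying_pinwheel_graph)
qed

lemma direction_graph_pinwheel: "direction_graph (pinwheel_graph n d p q)"
  by (rule extracted.direction_graph[OF uminus_dir_matrix])

lemma reachable_board:
  assumes "x \<in> board" "y \<in> board"
  shows "reachable (dg (pinwheel_graph n d p q)) x y"
proof -
  interpret pair_sym_digraph "underlying (pinwheel_graph n d p q)"
    using direction_graph_pinwheel by (simp add: direction_graph_def)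
  show ?thesis
    using symmetric_connected_imp_strongly_connected[OF sym_arcs] connected_leaper_graph assms
    by (auto simp: underlying_pinwheel_graph strongly_connected_def)
qed

lemma pinwheel_matrix_not_direction: "pinwheel_matrix n \<notin> dir_matrix ` directions"
  using n_pos unfolding dir_matrix_image pinwheel_matrix_def by (simp add: mat2_eq_iff)

text \<open>As the duality map is an involution, it also serves as the mapping \<open>\<eta>\<close> between the vertices of the
  graph and of its complement.\<close>

lemma dual_pinwheel_graph:
  "dual_direction_graph (pinwheel_graph n d p q)
     (relabel (dual_perm n) (pinwheel_graph n d p q)) (pinwheel_matrix n)"
  unfolding dual_direction_graph_def
proof (intro conjI)
  show "direction_graph (pinwheel_graph n d p q)"
    by (rule direction_graph_pinwheel)
  show "direction_graph (relabel (dual_perm n) (pinwheel_graph n d p q))"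
    by (rule complement.direction_graph[OF uminus_dir_matrix])
  show "pinwheel_matrix n \<notin> dir_matrix ` directions"
    by (rule pinwheel_matrix_not_direction)
  show "coherent (pinwheel_graph n d p q)"
    by (rule extracted.coherent)
  show "coherent (relabel (dual_perm n) (pinwheel_graph n d p q))"
    by (rule complement.coherent)
  show "Digraph_Component.connected (dg (pinwheel_graph n d p q))"
    "Digraph_Component.connected (dg (relabel (dual_perm n) (pinwheel_graph n d p q)))"
    by (simp_all add: underlying_pinwheel_graph connected_leaper_graph)
  let ?G = "underlying (pinwheel_graph n d p q)"
  have "parcs ?G \<subseteq> pverts ?G \<times> pverts ?G"
    unfolding underlying_pinwheel_graph by (rule parcs_leaper_graph)
  then have "pre_digraph.digraph_isomorphism (with_proj ?G) (pair_isomorphism id)"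
    "with_proj ?G = app_iso (pair_isomorphism id) (with_proj ?G)"
    using pair_isomorphism[of ?G ?G id] by simp_all
  then show "digraph_iso (dg (pinwheel_graph n d p q))
      (dg (relabel (dual_perm n) (pinwheel_graph n d p q)))"
    unfolding digraph_iso_def underlying_relabel by blast
  have "distance (pinwheel_graph n d p q) a b =
      dir_matrix (label (relabel (dual_perm n) (pinwheel_graph n d p q))
        (board_dual_map a, board_dual_map b)) ** pinwheel_matrix n"
    if ab: "a \<in> board" "b \<in> board"
      and arc: "(board_dual_map a, board_dual_map b) \<in>
        parcs (underlying (relabel (dual_perm n) (pinwheel_graph n d p q)))" for a b
  proof -
    have "dir_matrix (label (relabel (dual_perm n) (pinwheel_graph n d p q))
        (board_dual_map a, board_dual_map b)) =
      dual_turn n (half_matrix (dual_map n (coord b)) - half_matrix (dual_map n (coord a)))"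
      using complement.label_matrix[OF arc]
      by (simp add: coord_board_dual_map ab dual_turn_diff del: label_relabel)
    then have "dir_matrix (label (relabel (dual_perm n) (pinwheel_graph n d p q))
        (board_dual_map a, board_dual_map b)) ** pinwheel_matrix n =
      half_matrix (coord b) - half_matrix (coord a)"
      by (simp only: dual_turn_diff matrix_diff_mult dual_turn_pinwheel dual_map_involution)
    then show ?thesis
      using extracted.distance_eq[OF reachable_board[OF ab]] by simp
  qed
  then show "\<exists>\<eta>. bij_betw \<eta> (pverts ?G)
        (pverts (underlying (relabel (dual_perm n) (pinwheel_graph n d p q)))) \<and>
      (\<forall>a \<in> pverts ?G. \<forall>b \<in> pverts ?G.
        (\<eta> a, \<eta> b) \<in> parcs (underlying (relabel (dual_perm n) (pinwheel_graph n d p q))) \<longrightarrow>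
        distance (pinwheel_graph n d p q) a b =
          dir_matrix (label (relabel (dual_perm n) (pinwheel_graph n d p q)) (\<eta> a, \<eta> b))
            ** pinwheel_matrix n)"
    using bij_board_dual_map
    by (intro exI[of _ board_dual_map]) (simp add: underlying_pinwheel_graph)
qed

end

text \<open>Squares with equal quadruples correspond to each other, and adjacency and directions depend on
  the quadruples alone.\<close>

lemma same_pinwheel_graph:
  assumes "pinwheel_board n d p q" and "pinwheel_board n d p' q'"
  shows "same_direction_graph (pinwheel_graph n d p q) (pinwheel_graph n d p' q')"
proof -
  interpret P: pinwheel_board n d p q by fact
  interpret P': pinwheel_board n d p' q' by fact
  define f where "f = square_at p' q' \<circ> P.coord"
  have f_in: "f x \<in> P'.board" and coord_f: "P'.coord (f x) = P.coord x" if "x \<in> P.board" for x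
    using that by (simp_all add: f_def P.coord_in P'.square_at_in_board P'.coord_square_at)
  have f: "bij_betw f P.board P'.board"
    unfolding f_def by (rule bij_betw_trans[OF P.bij_coord P'.bij_square_at])
  let ?G = "leaper_graph (leaper p q) P.board" and ?G' = "leaper_graph (leaper p' q') P'.board"
  have arc: "(f u, f v) \<in> parcs ?G' \<longleftrightarrow> (u, v) \<in> parcs ?G"
    if "u \<in> pverts ?G" "v \<in> pverts ?G" for u v
    using that by (simp add: P.arc_iff_quad_step_0 P'.arc_iff_quad_step_0 f_in coord_f)
  have "label (pinwheel_graph n d p' q') (f x, f y) = label (pinwheel_graph n d p q) (x, y)"
    if e: "(x, y) \<in> parcs ?G" for x y
  proof -
    have xy: "x \<in> P.board" "y \<in> P.board"
      using e by (auto simp: leaper_graph_def)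
    then have e': "(f x, f y) \<in> parcs ?G'"
      using arc e by simp
    have "dir_matrix (label (pinwheel_graph n d p' q') (f x, f y)) =
        dir_matrix (label (pinwheel_graph n d p q) (x, y))"
      using P.extracted.label_matrix[of x y] P'.extracted.label_matrix[of "f x" "f y"] e e' xy
      by (simp add: P.underlying_pinwheel_graph P'.underlying_pinwheel_graph coord_f)
    then show ?thesis
      using P.extracted.label_in[of x y] P'.extracted.label_in[of "f x" "f y"] e e'
      by (auto simp: P.underlying_pinwheel_graph P'.underlying_pinwheel_graph
          dest: inj_onD[OF inj_on_dir_matrix])
  qed
  moreover have "iso_arcs (pair_isomorphism f) (x, y) = (f x, f y)" for x y
    by (simp add: pair_isomorphism_def)
  moreover have "pre_digraph.digraph_isomorphism (with_proj ?G) (pair_isomorphism f)"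
    and "with_proj ?G' = app_iso (pair_isomorphism f) (with_proj ?G)"
    using pair_isomorphism[OF parcs_leaper_graph parcs_leaper_graph _ arc] f by simp_all
  ultimately show ?thesis
    unfolding same_direction_graph_def P.underlying_pinwheel_graph P'.underlying_pinwheel_graph
    by (intro exI[of _ "pair_isomorphism f"]) auto
qed

theorem theorem25:
  fixes n d p q r s :: nat
  assumes "n > 0" and "d > 0"
    and "p \<noteq> 0" and "p < q"
    and "(vector [real r, real s] :: real ^ 2) = pinwheel_matrix n *v vector [real p, real q]"
  shows "dual_board (chessboard p q) (expanded_pinwheel n d p q) (leaper p q) (leaper r s) \<and>
    trivial_leaper_graph p q (expanded_pinwheel n d p q) \<and>
    (\<forall>p' q'. p' \<noteq> 0 \<and> p' < q' \<longrightarrow>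
       same_direction_graph (pinwheel_graph n d p q) (pinwheel_graph n d p' q')) \<and>
    (odd n \<longrightarrow>
       dual_direction_graph (pinwheel_graph n d p q)
         (relabel pi_pinwheel (pinwheel_graph n d p q)) (pinwheel_matrix n)) \<and>
    (even n \<longrightarrow>
       dual_direction_graph (pinwheel_graph n d p q)
         (relabel (pi_reflect \<circ> pi_pinwheel) (pinwheel_graph n d p q)) (pinwheel_matrix n))"
proof -
  have board: "pinwheel_board n d p' q'" if "p' \<noteq> 0" "p' < q'" for p' q'
    using assms(1,2) that by unfold_locales simp_all
  interpret pinwheel_board n d p q
    using board assms(3,4) .
  show ?thesis
    using board_is_dual[OF assms(5)] trivial_board dual_pinwheel_graph
      same_pinwheel_graph[OF board[OF assms(3,4)] board]
    by (auto simp: dual_perm_def)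
qed

end
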